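(* For every real number $\alpha>1/2$, the group $N_4$ of $4\times 4$ lower triangular matrices with integer entries and $1$'s on the diagonal does not embed into $\mathrm{Diff}_+^{1+\alpha}([0,1])$; that is, there is no injective group homomorphism $N_4\to \mathrm{Diff}_+^{1+\alpha}([0,1])$.
   Context: $\mathrm{Diff}_+^{1+\alpha}([0,1])$ is the group (under composition) of orientation-preserving $C^1$ diffeomorphisms $f$ of $[0,1]$ of class $C^{1+\alpha}$, meaning that the derivative is $\alpha$-Hölder continuous: there exists $C>0$ such that $|f'(x)-f'(y)|\le C|x-y|^\alpha$ for all $x,y\in[0,1]$. *)

theory Defs
  imports "HOL-Analysis.Analysis" "HOL-Algebra.Group"
begin

text \<open>
  In the type \<open>4\<close> the numeral \<open>4\<close> is \<open>0\<close>, and the order of the type is \<open>0 < 1 < 2 < 3\<close>: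
  the index \<open>0\<close> (printed \<open>4\<close> in library facts such as \<open>UNIV_4\<close>) is the first row and column.
\<close>

definition N4 :: "(int ^ 4 ^ 4) monoid" where
  "N4 = \<lparr>carrier = {A. (\<forall>i j. i < j \<longrightarrow> A $ i $ j = 0) \<and> (\<forall>i. A $ i $ i = 1)},
         mult = (**),
         one = mat 1\<rparr>"

text \<open>\<open>f\<close> is continuously differentiable on \<open>[0,1]\<close> with derivative \<open>f'\<close>, one-sided at the endpoints.\<close>

definition C1_deriv :: "(real \<Rightarrow> real) \<Rightarrow> (real \<Rightarrow> real) \<Rightarrow> bool" where
  "C1_deriv f f' \<longleftrightarrow>
     (\<forall>x\<in>{0..1}. (f has_real_derivative f' x) (at x within {0..1})) \<and> continuous_on {0..1} f'"

text \<open>At \<open>x = y\<close> the right-hand side is \<open>0\<close>, since \<open>0 powr \<alpha> = 0\<close>.\<close>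

definition holder_on01 :: "real \<Rightarrow> (real \<Rightarrow> real) \<Rightarrow> bool" where
  "holder_on01 \<alpha> g \<longleftrightarrow>
     (\<exists>C>0. \<forall>x\<in>{0..1}. \<forall>y\<in>{0..1}. \<bar>g x - g y\<bar> \<le> C * \<bar>x - y\<bar> powr \<alpha>)"

text \<open>
  A self-map of \<open>[0,1]\<close> is represented by a function on \<open>real\<close> that is \<open>undefined\<close> outside
  \<open>[0,1]\<close>, so that equal elements of the group are equal functions.
\<close>

definition Diff01 :: "real \<Rightarrow> (real \<Rightarrow> real) monoid" where
  "Diff01 \<alpha> =
     \<lparr>carrier = {f \<in> extensional {0..1}.
         bij_betw f {0..1} {0..1} \<and> strict_mono_on {0..1} f \<and>
         (\<exists>f'. C1_deriv f f' \<and> holder_on01 \<alpha> f') \<and>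
         (\<exists>g'. C1_deriv (inv_into {0..1} f) g')},
      mult = compose {0..1},
      one = (\<lambda>x\<in>{0..1}. x)\<rparr>"

lemma four_eq_zero: "(4::4) = 0"
  by (simp add: Rep_bit0_inject[symmetric] bit0.Rep_numeral bit0.Rep_0)

lemma forall_index4: "(\<forall>i::4. P i) \<longleftrightarrow> P 0 \<and> P 1 \<and> P 2 \<and> P 3"
  using forall_4[of P] by (auto simp: four_eq_zero)

lemma less_index4:
  "(0::4) < 1" "(0::4) < 2" "(0::4) < 3" "(1::4) < 2" "(1::4) < 3" "(2::4) < 3"
  by (simp_all add: less_bit0_def bit0.Rep_numeral bit0.Rep_1 bit0.Rep_0)

lemma N4_carrier:
  "A \<in> carrier N4 \<longleftrightarrow>
     A$0$0 = 1 \<and> A$1$1 = 1 \<and> A$2$2 = 1 \<and> A$3$3 = 1 \<and>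
     A$0$1 = 0 \<and> A$0$2 = 0 \<and> A$0$3 = 0 \<and> A$1$2 = 0 \<and> A$1$3 = 0 \<and> A$2$3 = 0"
  unfolding N4_def using less_index4
  by (auto simp: forall_index4 dest: less_asym)

lemma matrix_mult_index4:
  "((A :: int^4^4) ** B) $ i $ j = A$i$0 * B$0$j + A$i$1 * B$1$j + A$i$2 * B$2$j + A$i$3 * B$3$j"
  by (simp add: matrix_matrix_mult_def sum_4 four_eq_zero)

lemma N4_group: "Group.group N4"
proof (rule groupI)
  fix A B assume "A \<in> carrier N4" "B \<in> carrier N4"
  moreover have "mult N4 = (**)" by (simp add: N4_def)
  ultimately show "A \<otimes>\<^bsub>N4\<^esub> B \<in> carrier N4"
    unfolding N4_carrier by (simp add: matrix_mult_index4)
next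
  show "\<one>\<^bsub>N4\<^esub> \<in> carrier N4" by (auto simp: N4_def mat_def)
next
  fix A B C
  show "A \<otimes>\<^bsub>N4\<^esub> B \<otimes>\<^bsub>N4\<^esub> C = A \<otimes>\<^bsub>N4\<^esub> (B \<otimes>\<^bsub>N4\<^esub> C)"
    by (simp add: N4_def matrix_mul_assoc)
next
  fix A show "\<one>\<^bsub>N4\<^esub> \<otimes>\<^bsub>N4\<^esub> A = A" by (simp add: N4_def)
next
  fix A assume A: "A \<in> carrier N4"
  define a b c d e f where abcdef:
    "a = A$1$0" "b = A$2$1" "c = A$3$2" "d = A$2$0" "e = A$3$1" "f = A$3$0"
  define B :: "int^4^4" where "B = (\<chi> i j. if i = j then 1 else
     if i = 1 \<and> j = 0 then - a else if i = 2 \<and> j = 1 then - b else if i = 3 \<and> j = 2 then - c else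
     if i = 2 \<and> j = 0 then a * b - d else if i = 3 \<and> j = 1 then b * c - e else
     if i = 3 \<and> j = 0 then a * e + c * d - a * b * c - f else 0)"
  have "B \<in> carrier N4" using less_index4 by (auto simp: N4_carrier B_def)
  moreover have "B ** A = mat 1"
    using A less_index4
    by (auto simp: N4_carrier B_def vec_eq_iff forall_index4 matrix_mult_index4 mat_def abcdef
        algebra_simps)
  ultimately show "\<exists>B\<in>carrier N4. B \<otimes>\<^bsub>N4\<^esub> A = \<one>\<^bsub>N4\<^esub>"
    by (auto simp: N4_def)
qed

lemma C1_deriv_bounded:
  assumes "C1_deriv f f'"
  obtains L where "L > 0" "\<And>x. x \<in> {0..1} \<Longrightarrow> \<bar>f' x\<bar> \<le> L"
    "\<And>x y. x \<in> {0..1} \<Longrightarrow> y \<in> {0..1} \<Longrightarrow> \<bar>f x - f y\<bar> \<le> L * \<bar>x - y\<bar>"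
proof -
  have "compact (f' ` {0..1})"
    using assms by (intro compact_continuous_image) (auto simp: C1_deriv_def)
  then obtain L where L: "L > 0" "\<And>y. y \<in> f' ` {0..1} \<Longrightarrow> norm y \<le> L"
    using compact_imp_bounded bounded_pos by metis
  have "norm (f x - f y) \<le> L * norm (x - y)" if "x \<in> {0..1}" "y \<in> {0..1}" for x y
    using assms L that by (intro field_differentiable_bound[of "{0..1}" f f'])
      (auto simp: C1_deriv_def)
  with L show ?thesis by (intro that[of L]) auto
qed

lemma holder_on01_compose:
  assumes "\<alpha> > 0" "holder_on01 \<alpha> h" "g ` {0..1} \<subseteq> {0..1}" "L > 0"
    and lip: "\<And>x y. x \<in> {0..1} \<Longrightarrow> y \<in> {0..1} \<Longrightarrow> \<bar>g x - g y\<bar> \<le> L * \<bar>x - y\<bar>"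
  shows "holder_on01 \<alpha> (\<lambda>x. h (g x))"
proof -
  obtain C where C: "C > 0"
    "\<And>x y. x \<in> {0..1} \<Longrightarrow> y \<in> {0..1} \<Longrightarrow> \<bar>h x - h y\<bar> \<le> C * \<bar>x - y\<bar> powr \<alpha>"
    using assms(2) unfolding holder_on01_def by blast
  have "\<bar>h (g x) - h (g y)\<bar> \<le> C * L powr \<alpha> * \<bar>x - y\<bar> powr \<alpha>"
    if "x \<in> {0..1}" "y \<in> {0..1}" for x y
  proof -
    have "\<bar>h (g x) - h (g y)\<bar> \<le> C * \<bar>g x - g y\<bar> powr \<alpha>"
      using C(2) assms(3) that by blast
    also have "\<dots> \<le> C * (L * \<bar>x - y\<bar>) powr \<alpha>"
      using C(1) assms(1) lip[OF that] by (intro mult_left_mono powr_mono2) auto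
    finally show ?thesis using assms(4) by (simp add: powr_mult)
  qed
  then show ?thesis using C(1) assms(4) unfolding holder_on01_def
    by (intro exI[of _ "C * L powr \<alpha>"]) auto
qed

lemma holder_on01_mult:
  assumes "holder_on01 \<alpha> g" "holder_on01 \<alpha> h"
    and M: "\<And>x. x \<in> {0..1} \<Longrightarrow> \<bar>g x\<bar> \<le> M" and K: "\<And>x. x \<in> {0..1} \<Longrightarrow> \<bar>h x\<bar> \<le> K"
    and "M > 0" "K > 0"
  shows "holder_on01 \<alpha> (\<lambda>x. g x * h x)"
proof -
  obtain C where C: "C > 0"
    "\<And>x y. x \<in> {0..1} \<Longrightarrow> y \<in> {0..1} \<Longrightarrow> \<bar>g x - g y\<bar> \<le> C * \<bar>x - y\<bar> powr \<alpha>"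
    using assms(1) unfolding holder_on01_def by blast
  obtain D where D: "D > 0"
    "\<And>x y. x \<in> {0..1} \<Longrightarrow> y \<in> {0..1} \<Longrightarrow> \<bar>h x - h y\<bar> \<le> D * \<bar>x - y\<bar> powr \<alpha>"
    using assms(2) unfolding holder_on01_def by blast
  have "\<bar>g x * h x - g y * h y\<bar> \<le> (C * K + M * D) * \<bar>x - y\<bar> powr \<alpha>"
    if "x \<in> {0..1}" "y \<in> {0..1}" for x y
  proof -
    have "g x * h x - g y * h y = (g x - g y) * h x + g y * (h x - h y)"
      by (simp add: algebra_simps)
    then have "\<bar>g x * h x - g y * h y\<bar> \<le> \<bar>g x - g y\<bar> * \<bar>h x\<bar> + \<bar>g y\<bar> * \<bar>h x - h y\<bar>"
      by (metis abs_mult abs_triangle_ineq)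
    also have "\<dots> \<le> (C * \<bar>x - y\<bar> powr \<alpha>) * K + M * (D * \<bar>x - y\<bar> powr \<alpha>)"
      using C D M K that assms(5,6) by (intro add_mono mult_mono) auto
    finally show ?thesis by (simp add: algebra_simps)
  qed
  then show ?thesis using C(1) D(1) assms(5,6) unfolding holder_on01_def
    by (intro exI[of _ "C * K + M * D"]) (auto intro: add_pos_pos)
qed

lemma C1_deriv_cong:
  assumes "C1_deriv f f'" "\<And>x. x \<in> {0..1} \<Longrightarrow> f x = g x" "\<And>x. x \<in> {0..1} \<Longrightarrow> f' x = g' x"
  shows "C1_deriv g g'"
proof -
  have "(g has_real_derivative g' x) (at x within {0..1})" if "x \<in> {0..1}" for x
    using assms that unfolding C1_deriv_def
    by (metis has_field_derivative_transform_within zero_less_one)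
  moreover have "continuous_on {0..1} g'"
    using assms(1,3) continuous_on_cong[of "{0..1}" "{0..1}" f' g'] unfolding C1_deriv_def by auto
  ultimately show ?thesis unfolding C1_deriv_def by blast
qed

lemma C1_deriv_compose:
  assumes "C1_deriv f f'" "C1_deriv g g'" "g ` {0..1} \<subseteq> {0..1}"
  shows "C1_deriv (\<lambda>x. f (g x)) (\<lambda>x. f' (g x) * g' x)"
  unfolding C1_deriv_def
proof (intro conjI ballI)
  fix x :: real assume x: "x \<in> {0..1}"
  have "(f has_real_derivative f' (g x)) (at (g x) within g ` {0..1})"
    using assms x unfolding C1_deriv_def by (blast intro: DERIV_subset)
  then show "((\<lambda>x. f (g x)) has_real_derivative f' (g x) * g' x) (at x within {0..1})"
    using DERIV_image_chain[of f "f' (g x)" g x "{0..1}" "g' x"] assms(2) x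
    by (simp add: C1_deriv_def o_def)
next
  have "continuous_on {0..1} g"
    using assms(2) unfolding C1_deriv_def
    by (meson DERIV_continuous continuous_on_eq_continuous_within)
  moreover have "continuous_on {0..1} f'" "continuous_on {0..1} g'"
    using assms by (auto simp: C1_deriv_def)
  ultimately show "continuous_on {0..1} (\<lambda>x. f' (g x) * g' x)"
    using assms(3) by (intro continuous_intros continuous_on_compose2[of _ f' _ g]) auto
qed

lemma Diff01_carrier:
  "f \<in> carrier (Diff01 \<alpha>) \<longleftrightarrow> f \<in> extensional {0..1} \<and>
     bij_betw f {0..1} {0..1} \<and> strict_mono_on {0..1} f \<and>
     (\<exists>f'. C1_deriv f f' \<and> holder_on01 \<alpha> f') \<and>
     (\<exists>g'. C1_deriv (inv_into {0..1} f) g')"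
  by (simp add: Diff01_def)

lemma C1_deriv_inverse:
  assumes bij: "bij_betw f {0..1} {0..1}" and f: "C1_deriv f f'"
    and g: "C1_deriv (inv_into {0..1} f) g'" and y: "y \<in> {0..1}"
  shows "f' (inv_into {0..1} f y) * g' y = 1"
proof -
  define g where "g = inv_into {0..1} f"
  have gi: "g ` {0..1} \<subseteq> {0..1}"
    using bij_betw_inv_into[OF bij] by (simp add: g_def bij_betw_def)
  have fg: "f (g x) = x" if "x \<in> {0..1}" for x
    using bij that by (simp add: g_def bij_betw_inv_into_right)
  have "C1_deriv (\<lambda>x. f (g x)) (\<lambda>x. f' (g x) * g' x)"
    using C1_deriv_compose[OF f g] gi by (simp add: g_def)
  then have "C1_deriv (\<lambda>x. x) (\<lambda>x. f' (g x) * g' x)"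
    by (rule C1_deriv_cong) (use fg in auto)
  then have "((\<lambda>x. x) has_real_derivative f' (g y) * g' y) (at y within {0..1})"
    using y by (simp add: C1_deriv_def)
  moreover have "((\<lambda>x. x) has_real_derivative 1) (at y within {0..1})"
    by (rule DERIV_ident)
  ultimately show ?thesis
    using vector_derivative_unique_within_closed_interval[of 0 1 y "\<lambda>x. x"] y
    unfolding has_real_derivative_iff_has_vector_derivative g_def cbox_interval by simp
qed

lemma Diff01_compose:
  assumes "\<alpha> > 0" and f: "f \<in> carrier (Diff01 \<alpha>)" and g: "g \<in> carrier (Diff01 \<alpha>)"
  shows "compose {0..1} f g \<in> carrier (Diff01 \<alpha>)"
proof -
  obtain f' fi' where f': "C1_deriv f f'" "holder_on01 \<alpha> f'" "C1_deriv (inv_into {0..1} f) fi'"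
    using f Diff01_carrier by blast
  obtain g' gi' where g': "C1_deriv g g'" "holder_on01 \<alpha> g'" "C1_deriv (inv_into {0..1} g) gi'"
    using g Diff01_carrier by blast
  have bf: "bij_betw f {0..1} {0..1}" and bg: "bij_betw g {0..1} {0..1}"
    and sf: "strict_mono_on {0..1} f" and sg: "strict_mono_on {0..1} g"
    using f g Diff01_carrier by blast+
  have gi: "g ` {0..1} \<subseteq> {0..1}" using bg by (simp add: bij_betw_def)
  have fii: "inv_into {0..1} f ` {0..1} \<subseteq> {0..1}"
    using bij_betw_inv_into[OF bf] by (simp add: bij_betw_def)
  have bc: "bij_betw (compose {0..1} f g) {0..1} {0..1}"
    using bij_betw_compose[OF bg bf] .
  have mono: "strict_mono_on {0..1} (compose {0..1} f g)"
  proof (rule strict_mono_onI)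
    fix x y :: real assume xy: "x \<in> {0..1}" "y \<in> {0..1}" "x < y"
    have "g x < g y" using strict_mono_onD[OF sg xy] .
    moreover have "g x \<in> {0..1}" "g y \<in> {0..1}" using gi xy by blast+
    ultimately have "f (g x) < f (g y)" using strict_mono_onD[OF sf] by blast
    then show "compose {0..1} f g x < compose {0..1} f g y"
      using xy by (simp add: compose_def)
  qed
  have C1: "C1_deriv (compose {0..1} f g) (\<lambda>x. f' (g x) * g' x)"
    by (rule C1_deriv_cong[OF C1_deriv_compose[OF f'(1) g'(1) gi]]) (auto simp: compose_def)
  obtain L where L: "L > 0" "\<And>x. x \<in> {0..1} \<Longrightarrow> \<bar>g' x\<bar> \<le> L"
    "\<And>x y. x \<in> {0..1} \<Longrightarrow> y \<in> {0..1} \<Longrightarrow> \<bar>g x - g y\<bar> \<le> L * \<bar>x - y\<bar>"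
    using C1_deriv_bounded[OF g'(1)] by blast
  obtain K where K: "K > 0" "\<And>x. x \<in> {0..1} \<Longrightarrow> \<bar>f' x\<bar> \<le> K"
    "\<And>x y. x \<in> {0..1} \<Longrightarrow> y \<in> {0..1} \<Longrightarrow> \<bar>f x - f y\<bar> \<le> K * \<bar>x - y\<bar>"
    using C1_deriv_bounded[OF f'(1)] by blast
  have H: "holder_on01 \<alpha> (\<lambda>x. f' (g x) * g' x)"
    by (rule holder_on01_mult[OF holder_on01_compose[OF assms(1) f'(2) gi L(1,3)] g'(2), of K L])
      (use L K gi in blast)+
  have inv: "inv_into {0..1} (compose {0..1} f g) y = inv_into {0..1} g (inv_into {0..1} f y)"
    if y: "y \<in> {0..1}" for y
  proof (rule inv_into_f_eq)
    show "inj_on (compose {0..1} f g) {0..1}" using bc by (rule bij_betw_imp_inj_on)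
    have fy: "inv_into {0..1} f y \<in> {0..1}" using fii y by blast
    then show "inv_into {0..1} g (inv_into {0..1} f y) \<in> {0..1}"
      using bij_betw_inv_into[OF bg] by (auto simp only: bij_betw_def)
    then show "compose {0..1} f g (inv_into {0..1} g (inv_into {0..1} f y)) = y"
      by (simp only: compose_eq bij_betw_inv_into_right[OF bg fy] bij_betw_inv_into_right[OF bf y])
  qed
  have "C1_deriv (inv_into {0..1} (compose {0..1} f g))
      (\<lambda>x. gi' (inv_into {0..1} f x) * fi' x)"
    by (rule C1_deriv_cong[OF C1_deriv_compose[OF g'(3) f'(3) fii]]) (use inv in auto)
  with bc mono C1 H compose_extensional[of "{0..1}" f g] show ?thesis
    unfolding Diff01_carrier by blast
qed

lemma Diff01_inverse:
  assumes "\<alpha> > 0" and f: "f \<in> carrier (Diff01 \<alpha>)"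
  shows "restrict (inv_into {0..1} f) {0..1} \<in> carrier (Diff01 \<alpha>)"
proof -
  define g where "g = restrict (inv_into {0..1} f) {0..1}"
  obtain f' g' where f': "C1_deriv f f'" "holder_on01 \<alpha> f'" and g': "C1_deriv (inv_into {0..1} f) g'"
    using f Diff01_carrier by blast
  have bf: "bij_betw f {0..1} {0..1}" and sf: "strict_mono_on {0..1} f"
    using f Diff01_carrier by blast+
  have bg: "bij_betw g {0..1} {0..1}"
    unfolding g_def using bij_betw_inv_into[OF bf] by (simp add: bij_betw_restrict_eq)
  have gi: "g ` {0..1} \<subseteq> {0..1}" using bg by (simp add: bij_betw_def)
  have fg: "f (g y) = y" if "y \<in> {0..1}" for y
    using bij_betw_inv_into_right[OF bf that] that by (simp add: g_def)
  have mono: "strict_mono_on {0..1} g"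
  proof (rule strict_mono_onI)
    fix x y :: real assume xy: "x \<in> {0..1}" "y \<in> {0..1}" "x < y"
    have "g x \<in> {0..1}" "g y \<in> {0..1}" using gi xy by blast+
    then show "g x < g y"
      using sf fg[OF xy(1)] fg[OF xy(2)] xy(3) strict_mono_on_less[OF sf] by metis
  qed
  have C1: "C1_deriv g g'" by (rule C1_deriv_cong[OF g']) (auto simp: g_def)
  obtain L where L: "L > 0" "\<And>x. x \<in> {0..1} \<Longrightarrow> \<bar>g' x\<bar> \<le> L"
    "\<And>x y. x \<in> {0..1} \<Longrightarrow> y \<in> {0..1} \<Longrightarrow> \<bar>g x - g y\<bar> \<le> L * \<bar>x - y\<bar>"
    using C1_deriv_bounded[OF C1] by blast
  obtain C where C: "C > 0"
    "\<And>x y. x \<in> {0..1} \<Longrightarrow> y \<in> {0..1} \<Longrightarrow> \<bar>f' (g x) - f' (g y)\<bar> \<le> C * \<bar>x - y\<bar> powr \<alpha>"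
    using holder_on01_compose[OF assms(1) f'(2) gi L(1,3)] unfolding holder_on01_def by blast
  have "\<bar>g' x - g' y\<bar> \<le> L * L * C * \<bar>x - y\<bar> powr \<alpha>" if xy: "x \<in> {0..1}" "y \<in> {0..1}" for x y
  proof -
    have "f' (g x) * g' x = 1" "f' (g y) * g' y = 1"
      using C1_deriv_inverse[OF bf f'(1) g'] xy by (simp_all add: g_def)
    then have "g' x - g' y = g' x * g' y * (f' (g y) - f' (g x))"
      by (simp add: algebra_simps)
    then have "\<bar>g' x - g' y\<bar> = \<bar>g' x\<bar> * \<bar>g' y\<bar> * \<bar>f' (g y) - f' (g x)\<bar>"
      by (simp add: abs_mult)
    also have "\<dots> \<le> L * L * (C * \<bar>y - x\<bar> powr \<alpha>)"
      using L C xy by (intro mult_mono) auto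
    finally show ?thesis by (simp add: abs_minus_commute mult.assoc)
  qed
  then have H: "holder_on01 \<alpha> g'"
    using L(1) C(1) unfolding holder_on01_def by (intro exI[of _ "L * L * C"]) auto
  have "inv_into {0..1} g x = f x" if "x \<in> {0..1}" for x
  proof (rule inv_into_f_eq)
    show "inj_on g {0..1}" using bg by (simp add: bij_betw_def)
    show fx: "f x \<in> {0..1}" using bf that by (auto simp only: bij_betw_def)
    show "g (f x) = x" using bij_betw_inv_into_left[OF bf that] fx by (simp add: g_def)
  qed
  then have "C1_deriv (inv_into {0..1} g) f'"
    by (intro C1_deriv_cong[OF f'(1)]) auto
  then have "g \<in> carrier (Diff01 \<alpha>)"
    using bg mono C1 H unfolding Diff01_carrier by (auto simp: g_def)
  then show ?thesis by (simp add: g_def)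
qed

lemma Diff01_group:
  assumes "\<alpha> > 0"
  shows "Group.group (Diff01 \<alpha>)"
proof (rule groupI)
  fix f g assume "f \<in> carrier (Diff01 \<alpha>)" "g \<in> carrier (Diff01 \<alpha>)"
  then show "f \<otimes>\<^bsub>Diff01 \<alpha>\<^esub> g \<in> carrier (Diff01 \<alpha>)"
    using Diff01_compose[OF assms] by (simp add: Diff01_def)
next
  let ?i = "\<lambda>x\<in>{0..1}. x :: real"
  have bij: "bij_betw ?i {0..1} {0..1}"
    by (simp add: bij_betw_restrict_eq bij_betw_def)
  have C1: "C1_deriv (\<lambda>x. x) (\<lambda>x. 1)"
    by (auto simp: C1_deriv_def)
  have inv: "inv_into {0..1} ?i x = x" if "x \<in> {0..1}" for x
    using bij that by (intro inv_into_f_eq) (auto simp: bij_betw_def)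
  have "C1_deriv ?i (\<lambda>x. 1)" "C1_deriv (inv_into {0..1} ?i) (\<lambda>x. 1)"
    using inv by (auto intro!: C1_deriv_cong[OF C1])
  moreover have "holder_on01 \<alpha> (\<lambda>x. 1)"
    unfolding holder_on01_def by (auto intro: exI[of _ 1])
  moreover have "strict_mono_on {0..1} ?i" by (auto simp: strict_mono_on_def)
  ultimately show "\<one>\<^bsub>Diff01 \<alpha>\<^esub> \<in> carrier (Diff01 \<alpha>)"
    unfolding Diff01_carrier using bij by (auto simp: Diff01_def)
next
  fix f g h assume "h \<in> carrier (Diff01 \<alpha>)"
  then have "h ` {0..1} \<subseteq> {0..1}" by (simp add: Diff01_carrier bij_betw_def)
  then show "f \<otimes>\<^bsub>Diff01 \<alpha>\<^esub> g \<otimes>\<^bsub>Diff01 \<alpha>\<^esub> h = f \<otimes>\<^bsub>Diff01 \<alpha>\<^esub> (g \<otimes>\<^bsub>Diff01 \<alpha>\<^esub> h)"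
    by (auto simp: Diff01_def compose_def fun_eq_iff image_subset_iff)
next
  fix f assume f: "f \<in> carrier (Diff01 \<alpha>)"
  then have e: "f \<in> extensional {0..1}" and b: "bij_betw f {0..1} {0..1}"
    using Diff01_carrier by blast+
  then show "\<one>\<^bsub>Diff01 \<alpha>\<^esub> \<otimes>\<^bsub>Diff01 \<alpha>\<^esub> f = f"
    by (simp add: Diff01_def Id_compose bij_betw_imp_funcset)
  have "compose {0..1} (restrict (inv_into {0..1} f) {0..1}) f = (\<lambda>x\<in>{0..1}. x)"
    using b compose_inv_into_id by blast
  then show "\<exists>g\<in>carrier (Diff01 \<alpha>). g \<otimes>\<^bsub>Diff01 \<alpha>\<^esub> f = \<one>\<^bsub>Diff01 \<alpha>\<^esub>"
    using Diff01_inverse[OF assms f]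
    by (intro bexI[of _ "restrict (inv_into {0..1} f) {0..1}"]) (simp_all add: Diff01_def)
qed

end

theory Submission
  imports Defs
begin

text \<open>
  The matrices whose middle subdiagonal entry vanishes form a Heisenberg group over a four-dimensional
  symplectic lattice, whose center is generated by the corner element \<open>f\<close>.  If \<open>f\<close> acts
  nontrivially, let \<open>I = (l, r)\<close> be a component of the complement of its fixed point set.
  Commutators of \<open>n\<close>-th powers grow quadratically, whereas displacements measured in powers of
  \<open>f\<close> grow linearly, so the stabilizer of \<open>I\<close> is isotropic.  Hence some coordinate Lagrangian
  plane \<open>\<int>\<^sup>2\<close> moves \<open>I\<close> to pairwise disjoint intervals \<open>I\<^bsub>ij\<^esub>\<close>.  By Hoelder's inequality and averaging
  over lattice paths there are long paths along which \<open>\<Sum> \<bar>I\<^bsub>ij\<^esub>\<bar> powr \<beta>\<close> is bounded, which is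
  where \<open>\<beta> > 1/2\<close> enters.  The distortion along such paths is bounded, and Kopell's argument
  shows that \<open>f\<close> is the identity on \<open>I\<close>, a contradiction.
\<close>

section \<open>Sums of interval lengths and averaging over lattice paths\<close>

lemma sum_disjoint_intervals_le_1:
  fixes l r :: "'i \<Rightarrow> real"
  assumes "finite A"
    and in01: "\<And>i. i \<in> A \<Longrightarrow> 0 \<le> l i \<and> l i \<le> r i \<and> r i \<le> 1"
    and disj: "\<And>i j. i \<in> A \<Longrightarrow> j \<in> A \<Longrightarrow> i \<noteq> j \<Longrightarrow> r i \<le> l j \<or> r j \<le> l i"
  shows "(\<Sum>i\<in>A. r i - l i) \<le> 1"
proof -
  have "disjoint_family_on (\<lambda>i. {l i<..<r i}) A"
    using disj by (fastforce simp: disjoint_family_on_def)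
  then have "measure lborel (\<Union>i\<in>A. {l i<..<r i}) = (\<Sum>i\<in>A. measure lborel {l i<..<r i})"
    using in01 by (intro measure_finite_Union assms(1)) auto
  also have "\<dots> = (\<Sum>i\<in>A. r i - l i)"
    using in01 by (intro sum.cong) auto
  finally have "(\<Sum>i\<in>A. r i - l i) = measure lborel (\<Union>i\<in>A. {l i<..<r i})" ..
  also have "\<dots> \<le> measure lborel {0..1::real}"
    using in01 by (intro measure_mono_fmeasurable)
      (auto simp: fmeasurable_def assms(1) intro!: sets.finite_UN, force+)
  finally show ?thesis by simp
qed

text \<open>With \<open>w = c powr (1 / (1 - \<beta>))\<close> the left side is a weighted geometric
  mean of \<open>z\<close> and \<open>w\<close>, hence at most their maximum. Applied with
  \<open>c = 1 / n\<close>, it does the work of Hoelder's inequality on each layer of the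
  lattice.\<close>

lemma powr_interpolation_le:
  fixes z c \<beta> :: real
  assumes "0 \<le> z" "0 < c" "0 < \<beta>" "\<beta> < 1"
  shows "z powr \<beta> * c \<le> z + c powr (1 / (1 - \<beta>))"
proof -
  define w where "w = c powr (1 / (1 - \<beta>))"
  have w: "w > 0" "c = w powr (1 - \<beta>)" using assms by (auto simp: w_def powr_powr)
  show ?thesis
  proof (cases "z \<le> w")
    case True
    then have "z powr \<beta> * c \<le> w powr \<beta> * w powr (1 - \<beta>)"
      using assms w by (intro mult_mono powr_mono2) auto
    also have "\<dots> = w" using w(1) by (simp flip: powr_add)
    finally show ?thesis using assms by (simp add: w_def)
  next
    case False
    then have "z powr \<beta> * c \<le> z powr \<beta> * z powr (1 - \<beta>)"
      unfolding w(2) using assms w(1) by (intro mult_left_mono powr_mono2) auto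
    also have "\<dots> = z" using False w(1) by (simp flip: powr_add)
    finally show ?thesis using powr_ge_zero[of c "1 / (1 - \<beta>)"] by linarith
  qed
qed

lemma sum_div_eq:
  fixes g :: "nat \<Rightarrow> real"
  assumes "m > 0"
  shows "(\<Sum>k<n * m. g (k div m)) = real m * (\<Sum>j<n. g j)"
proof -
  have "(\<Sum>k<n * m. g (k div m)) = (\<Sum>j<n. \<Sum>k\<in>{j * m..<j * m + m}. g (k div m))"
    by (rule sum.nat_group[symmetric])
  also have "\<dots> = (\<Sum>j<n. \<Sum>k\<in>{j * m..<j * m + m}. g j)"
    using assms by (intro sum.cong refl arg_cong[where f = g])
      (auto simp: div_nat_eqI mult.commute)
  finally show ?thesis by (simp add: sum_distrib_left)
qed

text \<open>
  Averaging over the lattice paths \<open>n \<mapsto> (n - \<lfloor>tn\<rfloor>, \<lfloor>tn\<rfloor>)\<close> of slope \<open>t = k/M\<close>, \<open>0 \<le> k < M\<close>.  Since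
  \<open>n\<close> divides \<open>M = N!\<close>, their positions at time \<open>n \<le> N\<close> are uniformly distributed.
\<close>

lemma lattice_path_small_powr_sum:
  fixes a :: "nat \<Rightarrow> nat \<Rightarrow> real" and \<beta> :: real
  assumes \<beta>: "1/2 < \<beta>" "\<beta> < 1" and a0: "\<And>i j. 0 \<le> a i j"
    and sum_a: "\<And>N. (\<Sum>n=1..N. \<Sum>j<n. a (n - j) j) \<le> 1"
  obtains S where "\<And>N. \<exists>p. p 0 = 0 \<and> (\<forall>n>0. p n < n) \<and>
     (\<forall>n. p (Suc n) = p n \<or> p (Suc n) = Suc (p n)) \<and>
     (\<Sum>n=1..N. a (n - p n) (p n) powr \<beta>) \<le> S"
proof -
  define \<gamma> where "\<gamma> = - \<beta> / (1 - \<beta>)"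
  \<comment> \<open>Layer \<open>n\<close> has \<open>n\<close> points, each contributing
    \<open>(1 / n) powr (1 / (1 - \<beta>))\<close>, in total \<open>n powr \<gamma>\<close>. This
    is summable because \<beta> > 1/2 gives \<gamma> < -1.\<close>
  have \<gamma>: "\<gamma> < -1" "\<gamma> = 1 - 1 / (1 - \<beta>)" using \<beta> by (auto simp: \<gamma>_def field_simps)
  define Z where "Z = (\<Sum>n. real n powr \<gamma>)"
  have Z: "(\<Sum>n=1..N. real n powr \<gamma>) \<le> Z" for N
    unfolding Z_def using \<gamma>(1) by (intro sum_le_suminf) (auto simp: summable_real_powr_iff)
  have bound: "(\<Sum>n=1..N. (\<Sum>j<n. a (n - j) j powr \<beta>) / n) \<le> 1 + Z" for N
  proof -
    have "(\<Sum>j<n. a (n - j) j powr \<beta>) / n \<le> (\<Sum>j<n. a (n - j) j) + real n powr \<gamma>"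
      if "n \<ge> 1" for n
    proof -
      have "(\<Sum>j<n. a (n - j) j powr \<beta>) / n = (\<Sum>j<n. a (n - j) j powr \<beta> * (1 / n))"
        by (simp add: sum_divide_distrib)
      also have "\<dots> \<le> (\<Sum>j<n. a (n - j) j + (1 / n) powr (1 / (1 - \<beta>)))"
        using \<beta> a0 that by (intro sum_mono powr_interpolation_le) auto
      also have "\<dots> = (\<Sum>j<n. a (n - j) j) + real n * (1 / n) powr (1 / (1 - \<beta>))"
        by (simp add: sum.distrib)
      also have "real n * (1 / n) powr (1 / (1 - \<beta>)) = real n powr \<gamma>"
        using that unfolding \<gamma>(2) powr_diff by (simp add: powr_divide)
      finally show ?thesis .
    qed
    then have "(\<Sum>n=1..N. (\<Sum>j<n. a (n - j) j powr \<beta>) / n)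
        \<le> (\<Sum>n=1..N. (\<Sum>j<n. a (n - j) j) + real n powr \<gamma>)"
      by (intro sum_mono) auto
    also have "\<dots> = (\<Sum>n=1..N. \<Sum>j<n. a (n - j) j) + (\<Sum>n=1..N. real n powr \<gamma>)"
      by (rule sum.distrib)
    also have "\<dots> \<le> 1 + Z" using sum_a[of N] Z[of N] by (intro add_mono)
    finally show ?thesis .
  qed
  show ?thesis
  proof (rule that[of "1 + Z"])
    fix N :: nat
    define M :: nat where "M = fact N"
    have M: "M > 0" by (simp add: M_def)
    let ?s = "\<lambda>k. \<Sum>n=1..N. a (n - k * n div M) (k * n div M) powr \<beta>"
    have "(\<Sum>k<M. a (n - k * n div M) (k * n div M) powr \<beta>)
        = real M * ((\<Sum>j<n. a (n - j) j powr \<beta>) / n)" if n: "n \<in> {1..N}" for n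
    proof -
      have "n dvd M" unfolding M_def using n by (intro dvd_fact) auto
      then obtain m where m: "M = n * m" ..
      then have "m > 0" "n > 0" using M by auto
      then have "k * n div M = k div m" for k
        by (simp add: m mult.commute[of k])
      then have "(\<Sum>k<M. a (n - k * n div M) (k * n div M) powr \<beta>)
          = (\<Sum>k<n * m. a (n - k div m) (k div m) powr \<beta>)" by (simp add: m)
      also have "\<dots> = real m * (\<Sum>j<n. a (n - j) j powr \<beta>)"
        using sum_div_eq[OF \<open>m > 0\<close>, of "\<lambda>j. a (n - j) j powr \<beta>"] by simp
      finally show ?thesis using \<open>n > 0\<close> by (simp add: m)
    qed
    then have "(\<Sum>k<M. ?s k) = real M * (\<Sum>n=1..N. (\<Sum>j<n. a (n - j) j powr \<beta>) / n)"
      by (subst sum.swap) (simp add: sum_distrib_left)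
    also have "\<dots> \<le> real M * (1 + Z)" using bound by (intro mult_left_mono) auto
    also have "\<dots> = (\<Sum>k<M. 1 + Z)" by simp
    \<comment> \<open>The average over all \<open>M\<close> slopes is at most \<open>1 + Z\<close>,
      so some slope meets this bound, which does not depend on \<open>N\<close>.\<close>
    finally have "\<exists>k<M. ?s k \<le> 1 + Z"
      using sum_strict_mono[of "{..<M}" "\<lambda>_. 1 + Z" ?s] M by (force simp: not_le)
    then obtain k where k: "k < M" "?s k \<le> 1 + Z" by blast
    show "\<exists>p. p 0 = 0 \<and> (\<forall>n>0. p n < n) \<and>
        (\<forall>n. p (Suc n) = p n \<or> p (Suc n) = Suc (p n)) \<and>
        (\<Sum>n=1..N. a (n - p n) (p n) powr \<beta>) \<le> 1 + Z"
    proof (intro exI[of _ "\<lambda>n. k * n div M"] conjI allI)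
      show "0 < n \<longrightarrow> k * n div M < n" for n
        using k(1) M by (simp add: div_less_iff_less_mult mult.commute)
      fix n
      have "k * n div M \<le> k * Suc n div M" by (intro div_le_mono) simp
      moreover have "k * Suc n div M \<le> (k * n + M) div M" using k(1) by (intro div_le_mono) simp
      moreover have "(k * n + M) div M = Suc (k * n div M)" using M by simp
      ultimately show "k * Suc n div M = k * n div M \<or> k * Suc n div M = Suc (k * n div M)"
        by linarith
    qed (use k(2) in simp_all)
  qed
qed

section \<open>Distortion estimates\<close>

text \<open>This controls the oscillation of \<open>ln g'\<close> for increasing \<open>g\<close>,
  written with cross-multiplied difference quotients so that the bounds multiply along compositions.
  The reverse inequality comes from exchanging the two pairs of points.\<close>

definition distortion_bound :: "real \<Rightarrow> real \<Rightarrow> (real \<Rightarrow> real) \<Rightarrow> bool" where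
  "distortion_bound \<beta> C g \<longleftrightarrow> (\<forall>p q x y s t. 0 \<le> p \<longrightarrow> q \<le> 1 \<longrightarrow> {x, y, s, t} \<subseteq> {p..q} \<longrightarrow>
     x < y \<longrightarrow> s < t \<longrightarrow>
     (g y - g x) * (t - s) \<le> exp (C * (q - p) powr \<beta>) * ((g t - g s) * (y - x)))"

lemma distortion_boundD:
  assumes "distortion_bound \<beta> C g" "0 \<le> p" "q \<le> 1" "{x, y, s, t} \<subseteq> {p..q}" "x < y" "s < t"
  shows "(g y - g x) * (t - s) \<le> exp (C * (q - p) powr \<beta>) * ((g t - g s) * (y - x))"
  using assms unfolding distortion_bound_def by blast

lemma distortion_bound_mono:
  assumes "distortion_bound \<beta> C g" "C \<le> D" "strict_mono_on {0..1} g"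
  shows "distortion_bound \<beta> D g"
  unfolding distortion_bound_def
proof (intro allI impI)
  fix p q x y s t :: real
  assume *: "0 \<le> p" "q \<le> 1" "{x, y, s, t} \<subseteq> {p..q}" "x < y" "s < t"
  have "s \<in> {0..1}" "t \<in> {0..1}" using * by auto
  then have "g s < g t" using strict_mono_onD[OF assms(3)] * by blast
  have "(g y - g x) * (t - s) \<le> exp (C * (q - p) powr \<beta>) * ((g t - g s) * (y - x))"
    by (rule distortion_boundD[OF assms(1) *])
  also have "\<dots> \<le> exp (D * (q - p) powr \<beta>) * ((g t - g s) * (y - x))"
    using assms(2) \<open>g s < g t\<close> * by (intro mult_right_mono) auto
  finally show "(g y - g x) * (t - s) \<le> exp (D * (q - p) powr \<beta>) * ((g t - g s) * (y - x))" .
qed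

lemma C1_deriv_mvt:
  assumes "C1_deriv g g'" "0 \<le> x" "x < y" "y \<le> 1"
  obtains z where "x < z" "z < y" "g y - g x = g' z * (y - x)"
proof -
  have "\<And>z. x \<le> z \<Longrightarrow> z \<le> y \<Longrightarrow> (g has_derivative (*) (g' z)) (at z within {x..y})"
    using assms unfolding C1_deriv_def has_field_derivative_def
    by (auto intro: has_derivative_subset[of g _ _ "{0..1}"])
  then obtain z where "z \<in> {x<..<y}" "g y - g x = g' z * (y - x)"
    using mvt_simple[OF assms(3), of g "\<lambda>z. (*) (g' z)"] by auto
  then show ?thesis using that by auto
qed

text \<open>The mean value theorem replaces both quotients by values of \<open>g'\<close>. Their
  difference is small by the Hoelder condition, and as \<open>g'\<close> is bounded away from
  \<open>0\<close> this controls their ratio. The exponent may be lowered to \<beta> because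
  distances in \<open>[0,1]\<close> are at most \<open>1\<close>.\<close>

lemma Diff01_distortion_bound:
  assumes "0 < \<beta>" "\<beta> \<le> \<alpha>" "g \<in> carrier (Diff01 \<alpha>)"
  obtains C where "C > 0" "distortion_bound \<beta> C g"
proof -
  obtain g' k' where g': "C1_deriv g g'" "holder_on01 \<alpha> g'"
      and k': "C1_deriv (inv_into {0..1} g) k'"
      and bij: "bij_betw g {0..1} {0..1}" and mono: "strict_mono_on {0..1} g"
    using assms Diff01_carrier by blast
  obtain L where L: "L > 0" "\<And>x. x \<in> {0..1} \<Longrightarrow> \<bar>k' x\<bar> \<le> L"
    using C1_deriv_bounded[OF k'] by metis
  obtain D where D: "D > 0"
    "\<And>x y. x \<in> {0..1} \<Longrightarrow> y \<in> {0..1} \<Longrightarrow> \<bar>g' x - g' y\<bar> \<le> D * \<bar>x - y\<bar> powr \<alpha>"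
    using g'(2) unfolding holder_on01_def by blast
  \<comment> \<open>The derivative of the inverse is bounded by \<open>L\<close>, which bounds
    \<open>g'\<close> from below.\<close>
  have lower: "1 \<le> L * \<bar>g' x\<bar>" if x: "x \<in> {0..1}" for x
  proof -
    have gx: "g x \<in> {0..1}" using bij x by (auto simp only: bij_betw_def)
    have "g' x * k' (g x) = 1"
      using C1_deriv_inverse[OF bij g'(1) k' gx] bij_betw_inv_into_left[OF bij x] by simp
    then have "1 = \<bar>g' x\<bar> * \<bar>k' (g x)\<bar>" by (simp flip: abs_mult)
    also have "\<dots> \<le> \<bar>g' x\<bar> * L" using L(2)[OF gx] by (intro mult_left_mono) auto
    finally show ?thesis by (simp add: mult.commute)
  qed
  have "distortion_bound \<beta> (D * L) g"
    unfolding distortion_bound_def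
  proof (intro allI impI)
    fix p q x y s t :: real
    assume pq: "0 \<le> p" "q \<le> 1" and sub: "{x, y, s, t} \<subseteq> {p..q}" and xy: "x < y" and st: "s < t"
    obtain \<xi> where \<xi>: "x < \<xi>" "\<xi> < y" "g y - g x = g' \<xi> * (y - x)"
      using C1_deriv_mvt[OF g'(1), of x y] pq sub xy by auto
    obtain \<eta> where \<eta>: "s < \<eta>" "\<eta> < t" "g t - g s = g' \<eta> * (t - s)"
      using C1_deriv_mvt[OF g'(1), of s t] pq sub st by auto
    have in01: "\<xi> \<in> {0..1}" "\<eta> \<in> {0..1}" using pq sub \<xi> \<eta> by auto
    have "g s < g t" using strict_mono_onD[OF mono _ _ st] pq sub by auto
    then have pos: "g' \<eta> > 0" using \<eta>(3) st by (metis diff_gt_0_iff_gt zero_less_mult_pos2)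
    have "\<bar>\<xi> - \<eta>\<bar> powr \<alpha> \<le> \<bar>\<xi> - \<eta>\<bar> powr \<beta>"
      using in01 assms by (intro powr_mono') auto
    also have "\<dots> \<le> (q - p) powr \<beta>"
      using sub \<xi> \<eta> assms by (intro powr_mono2) auto
    finally have "\<bar>g' \<xi> - g' \<eta>\<bar> \<le> D * (q - p) powr \<beta>"
      using D(2)[OF in01] D(1) by (meson mult_left_mono order.trans less_imp_le)
    also have "\<dots> \<le> D * (q - p) powr \<beta> * (L * g' \<eta>)"
      using mult_left_mono[of 1 "L * g' \<eta>" "D * (q - p) powr \<beta>"] lower[OF in01(2)] pos D(1) by simp
    finally have "g' \<xi> \<le> (1 + D * L * (q - p) powr \<beta>) * g' \<eta>"
      by (simp add: algebra_simps)
    also have "\<dots> \<le> exp (D * L * (q - p) powr \<beta>) * g' \<eta>"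
      using pos by (intro mult_right_mono exp_ge_add_one_self) auto
    finally have "g' \<xi> * ((y - x) * (t - s)) \<le> exp (D * L * (q - p) powr \<beta>) * g' \<eta> * ((y - x) * (t - s))"
      using xy st by (intro mult_right_mono) auto
    then show "(g y - g x) * (t - s) \<le> exp (D * L * (q - p) powr \<beta>) * ((g t - g s) * (y - x))"
      unfolding \<xi>(3) \<eta>(3) by (simp add: algebra_simps)
  qed
  then show ?thesis using that[of "D * L"] L(1) D(1) by simp
qed

text \<open>Between two fixed points there is a point where \<open>f'\<close> is \<open>1\<close>,
  and uniform continuity keeps \<open>f'\<close> close to \<open>1\<close> on a short interval
  around it. Since \<delta> does not depend on the interval, it can be fixed before the interval is
  found.\<close>

lemma near_identity_between_fixed_points:
  assumes f: "C1_deriv f f'" and "\<epsilon> > 0"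
  obtains \<delta> where "\<delta> > 0" "\<And>p q x y. 0 \<le> p \<Longrightarrow> q \<le> 1 \<Longrightarrow> f p = p \<Longrightarrow> f q = q \<Longrightarrow> q - p < \<delta> \<Longrightarrow>
     p \<le> x \<Longrightarrow> x < y \<Longrightarrow> y \<le> q \<Longrightarrow> (1 - \<epsilon>) * (y - x) \<le> f y - f x"
proof -
  have "uniformly_continuous_on {0..1} f'"
    using f by (intro compact_uniformly_continuous) (auto simp: C1_deriv_def)
  then obtain \<delta> where \<delta>: "\<delta> > 0"
    "\<And>x y. x \<in> {0..1} \<Longrightarrow> y \<in> {0..1} \<Longrightarrow> \<bar>x - y\<bar> < \<delta> \<Longrightarrow> \<bar>f' x - f' y\<bar> < \<epsilon>"
    using \<open>\<epsilon> > 0\<close> unfolding uniformly_continuous_on_def dist_real_def by metis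
  have "(1 - \<epsilon>) * (y - x) \<le> f y - f x"
    if pq: "0 \<le> p" "q \<le> 1" "f p = p" "f q = q" "q - p < \<delta>" "p \<le> x" "x < y" "y \<le> q" for p q x y
  proof -
    obtain z where z: "p < z" "z < q" "f q - f p = f' z * (q - p)"
      using C1_deriv_mvt[OF f, of p q] pq by auto
    then have "f' z = 1" using that by simp
    obtain w where w: "x < w" "w < y" "f y - f x = f' w * (y - x)"
      using C1_deriv_mvt[OF f, of x y] pq by auto
    have "\<bar>f' z - f' w\<bar> < \<epsilon>" using that z w by (intro \<delta>(2)) auto
    then have "1 - \<epsilon> \<le> f' w" using \<open>f' z = 1\<close> by auto
    then show ?thesis unfolding w(3) using that by (intro mult_right_mono) auto
  qed
  with \<delta>(1) show ?thesis using that by blast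
qed


section \<open>Kopell's argument along lattice paths\<close>

text \<open>
  A two-dimensional Kopell lemma: along a lattice path on which \<open>\<Sum> \<bar>I\<bar> powr \<beta>\<close> is bounded, the
  distortion on \<open>[l, r]\<close> is bounded, while \<open>f\<close> is nearly the identity on the small interval at the
  end of the path.  Hence the gaps \<open>f ^ (k+1) x0 - f ^ k x0\<close> cannot tend to \<open>0\<close>.
\<close>

lemma no_two_dimensional_wandering_interval:
  fixes X :: "nat \<Rightarrow> nat \<Rightarrow> real \<Rightarrow> real" and f :: "real \<Rightarrow> real"
  assumes \<beta>: "1/2 < \<beta>" "\<beta> < 1"
    and dist: "distortion_bound \<beta> C u" "distortion_bound \<beta> C v" and C: "C > 0"
    and f: "C1_deriv f f'"
    and lr: "0 \<le> l" "r \<le> 1" and x0: "l < x0" "x0 < r" "x0 < f x0"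
    and fI: "\<And>x. x \<in> {l..r} \<Longrightarrow> f x \<in> {l..r}" and f_lr: "f l = l" "f r = r"
    and f_mono: "\<And>x y. x \<in> {l..r} \<Longrightarrow> y \<in> {l..r} \<Longrightarrow> x < y \<Longrightarrow> f x < f y"
    and X0: "\<And>x. x \<in> {l..r} \<Longrightarrow> X 0 0 x = x"
    and Xu: "\<And>i j x. x \<in> {l..r} \<Longrightarrow> X (Suc i) j x = u (X i j x)"
    and Xv: "\<And>i j x. x \<in> {l..r} \<Longrightarrow> X i (Suc j) x = v (X i j x)"
    and Xf: "\<And>i j x. x \<in> {l..r} \<Longrightarrow> f (X i j x) = X i j (f x)"
    and X01: "\<And>i j x. x \<in> {l..r} \<Longrightarrow> X i j x \<in> {0..1}"
    and X_mono: "\<And>i j x y. x \<in> {l..r} \<Longrightarrow> y \<in> {l..r} \<Longrightarrow> x < y \<Longrightarrow> X i j x < X i j y"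
    and disj: "\<And>i j i' j'. (i, j) \<noteq> (i', j') \<Longrightarrow> X i j r \<le> X i' j' l \<or> X i' j' r \<le> X i j l"
  shows False
proof -
  define a where "a i j = X i j r - X i j l" for i j
  have l_r: "l \<in> {l..r}" "r \<in> {l..r}" "l < r" using x0 by auto
  have a0: "0 < a i j" for i j using X_mono[OF l_r] by (simp add: a_def)
  have sum_a: "(\<Sum>n=1..N. \<Sum>j<n. a (n - j) j) \<le> 1" for N
  proof -
    let ?A = "SIGMA n:{1..N}. {..<n}"
    have "(\<Sum>n=1..N. \<Sum>j<n. a (n - j) j)
        = (\<Sum>k\<in>?A. X (fst k - snd k) (snd k) r - X (fst k - snd k) (snd k) l)"
      by (subst sum.Sigma) (auto simp: a_def case_prod_unfold)
    also have "\<dots> \<le> 1"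
    proof (rule sum_disjoint_intervals_le_1)
      show "0 \<le> X (fst k - snd k) (snd k) l \<and> X (fst k - snd k) (snd k) l \<le> X (fst k - snd k) (snd k) r
          \<and> X (fst k - snd k) (snd k) r \<le> 1" for k :: "nat \<times> nat"
        using X01[OF l_r(1)] X01[OF l_r(2)] X_mono[OF l_r] by (auto intro: less_imp_le)
      fix k k' assume "k \<in> ?A" "k' \<in> ?A" "k \<noteq> k'"
      then have "(fst k - snd k, snd k) \<noteq> (fst k' - snd k', snd k')" by auto
      then show "X (fst k - snd k) (snd k) r \<le> X (fst k' - snd k') (snd k') l \<or>
          X (fst k' - snd k') (snd k') r \<le> X (fst k - snd k) (snd k) l" by (rule disj)
    qed auto
    finally show ?thesis .
  qed
  obtain S where S: "\<And>N. \<exists>p. p 0 = 0 \<and> (\<forall>n>0. p n < n) \<and>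
     (\<forall>n. p (Suc n) = p n \<or> p (Suc n) = Suc (p n)) \<and>
     (\<Sum>n=1..N. a (n - p n) (p n) powr \<beta>) \<le> S"
    using lattice_path_small_powr_sum[of \<beta> a, OF \<beta> less_imp_le[OF a0] sum_a] by blast
  \<comment> \<open>The term \<open>a 0 0\<close> is added because the bound \<open>S\<close> starts
    at \<open>n = 1\<close> while paths start at the origin. \<open>K\<close> depends neither on the
    path nor on its length.\<close>
  define K where "K = exp (C * (a 0 0 powr \<beta> + S))"
  have fk_in: "(f ^^ k) x \<in> {l..r}" if "x \<in> {l..r}" for k x
    using that fI by (induction k) auto
  have fx0: "x0 \<in> {l..r}" "f x0 \<in> {l..r}" using x0 fI[of x0] by auto
  have gap_pos: "(f ^^ k) x0 < (f ^^ Suc k) x0" for k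
  proof (induction k)
    case (Suc k)
    then show ?case using f_mono[OF fk_in fk_in, OF fx0(1) fx0(1), of k "Suc k"] by simp
  qed (use x0 in simp)
  have gap: "f x0 - x0 \<le> 2 * K * ((f ^^ Suc k) x0 - (f ^^ k) x0)" for k
  proof -
    \<comment> \<open>Chosen so that \<open>(1 - \<epsilon>) ^ k\<close> is at least
      \<open>1/2\<close> by Bernoulli's inequality.\<close>
    define \<epsilon> where "\<epsilon> = 1 / (2 * real k + 2)"
    have \<epsilon>: "\<epsilon> > 0" "\<epsilon> \<le> 1" "real k * \<epsilon> \<le> 1/2" by (auto simp: \<epsilon>_def field_simps)
    obtain \<delta> where \<delta>: "\<delta> > 0" "\<And>p q x y. 0 \<le> p \<Longrightarrow> q \<le> 1 \<Longrightarrow> f p = p \<Longrightarrow> f q = q \<Longrightarrow>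
        q - p < \<delta> \<Longrightarrow> p \<le> x \<Longrightarrow> x < y \<Longrightarrow> y \<le> q \<Longrightarrow> (1 - \<epsilon>) * (y - x) \<le> f y - f x"
      using near_identity_between_fixed_points[OF f \<epsilon>(1)] by metis
    \<comment> \<open>The layer sums tend to \<open>0\<close>, so at some time \<open>N\<close>
      every interval of the layer is shorter than \<delta>. Thus \<open>N\<close> can be fixed first
      and the path chosen depending on it.\<close>
    have "summable (\<lambda>n. \<Sum>j<n. a (n - j) j)"
    proof (rule summableI_nonneg_bounded)
      show "0 \<le> (\<Sum>j<n. a (n - j) j)" for n using a0 by (intro sum_nonneg less_imp_le)
      show "(\<Sum>n<m. \<Sum>j<n. a (n - j) j) \<le> 1" for m
      proof -
        have "(\<Sum>n<m. \<Sum>j<n. a (n - j) j) \<le> (\<Sum>n\<in>insert 0 {1..m}. \<Sum>j<n. a (n - j) j)"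
          using a0 by (intro sum_mono2 sum_nonneg less_imp_le) auto
        then show ?thesis using sum_a[of m] by simp
      qed
    qed
    then have "eventually (\<lambda>n. (\<Sum>j<n. a (n - j) j) < \<delta>) sequentially"
      using \<delta>(1) by (intro order_tendstoD(2)[OF summable_LIMSEQ_zero]) auto
    then obtain N0 where "\<And>n. n \<ge> N0 \<Longrightarrow> (\<Sum>j<n. a (n - j) j) < \<delta>"
      unfolding eventually_sequentially by blast
    then obtain N where N: "N > 0" "(\<Sum>j<N. a (N - j) j) < \<delta>"
      by (meson le_SucI le_refl zero_less_Suc)
    obtain p where p: "p 0 = 0" "\<And>n. n > 0 \<Longrightarrow> p n < n" "\<And>n. p (Suc n) = p n \<or> p (Suc n) = Suc (p n)"
      "(\<Sum>n=1..N. a (n - p n) (p n) powr \<beta>) \<le> S"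
      using S[of N] by blast
    have p_le: "p n \<le> n" for n using p(1) p(2)[of n] by (cases "n = 0") auto
    define Y where "Y n = X (n - p n) (p n)" for n
    have Y_lr: "Y n x \<in> {Y n l..Y n r}" if "x \<in> {l..r}" for n x
      using that X_mono[OF l_r(1) that, of "n - p n" "p n"] X_mono[OF that l_r(2), of "n - p n" "p n"]
      by (cases "x = l"; cases "x = r") (auto simp: Y_def)
    have Y_mono: "Y n x < Y n y" if "x \<in> {l..r}" "y \<in> {l..r}" "x < y" for n x y
      using X_mono that by (simp add: Y_def)
    have Y01: "0 \<le> Y n l" "Y n r \<le> 1" for n
      using X01[OF l_r(1)] X01[OF l_r(2)] by (auto simp: Y_def)
    have Y_Suc: "\<exists>g. distortion_bound \<beta> C g \<and> (\<forall>x\<in>{l..r}. Y (Suc n) x = g (Y n x))" for n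
      using p(3)[of n]
    proof
      assume "p (Suc n) = p n"
      then have "\<forall>x\<in>{l..r}. Y (Suc n) x = u (Y n x)"
        using p_le[of n] Xu by (simp add: Y_def Suc_diff_le)
      with dist show ?thesis by blast
    next
      assume "p (Suc n) = Suc (p n)"
      then have "\<forall>x\<in>{l..r}. Y (Suc n) x = v (Y n x)" using Xv by (simp add: Y_def)
      with dist show ?thesis by blast
    qed
    \<comment> \<open>Along the path the distortion factors of the successive maps multiply, so the
      exponents add up over the intervals visited.\<close>
    have Y_distortion: "(Y n y - Y n x) * (t - s)
        \<le> exp (C * (\<Sum>i<n. a (i - p i) (p i) powr \<beta>)) * ((Y n t - Y n s) * (y - x))"
      if "{x, y, s, t} \<subseteq> {l..r}" "x < y" "s < t" for n x y s t
    proof (induction n)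
      case 0
      then show ?case using that X0 by (simp add: Y_def p(1))
    next
      case (Suc n)
      let ?d = "C * a (n - p n) (p n) powr \<beta>" and ?s = "C * (\<Sum>i<n. a (i - p i) (p i) powr \<beta>)"
      obtain g where g: "distortion_bound \<beta> C g" "\<And>x. x \<in> {l..r} \<Longrightarrow> Y (Suc n) x = g (Y n x)"
        using Y_Suc by blast
      let ?yx = "Y n y - Y n x" and ?ts = "Y n t - Y n s"
      have pos: "?yx > 0" "?ts > 0" using Y_mono that by auto
      have "{Y n x, Y n y, Y n s, Y n t} \<subseteq> {Y n l..Y n r}" using Y_lr that(1) by blast
      then have "(g (Y n y) - g (Y n x)) * ?ts
          \<le> exp (C * (Y n r - Y n l) powr \<beta>) * ((g (Y n t) - g (Y n s)) * ?yx)"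
        using pos by (intro distortion_boundD[OF g(1) Y01]) simp_all
      then have "(Y (Suc n) y - Y (Suc n) x) * ?ts \<le> exp ?d * ((Y (Suc n) t - Y (Suc n) s) * ?yx)"
        using that(1) unfolding a_def Y_def[symmetric] by (simp add: g(2))
      then have "(Y (Suc n) y - Y (Suc n) x) * ?ts * (t - s)
          \<le> exp ?d * ((Y (Suc n) t - Y (Suc n) s) * ?yx) * (t - s)"
        using that by (intro mult_right_mono) auto
      also have "\<dots> = exp ?d * (Y (Suc n) t - Y (Suc n) s) * (?yx * (t - s))" by simp
      also have "\<dots> \<le> exp ?d * (Y (Suc n) t - Y (Suc n) s) * (exp ?s * (?ts * (y - x)))"
        using Suc.IH Y_mono[of s t "Suc n"] that by (intro mult_left_mono) auto
      finally have "((Y (Suc n) y - Y (Suc n) x) * (t - s)) * ?ts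
          \<le> (exp (?s + ?d) * ((Y (Suc n) t - Y (Suc n) s) * (y - x))) * ?ts"
        by (simp add: exp_add mult_ac)
      then show ?case using pos(2) by (simp add: distrib_left)
    qed
    have Yf: "f (Y n x) = Y n (f x)" if "x \<in> {l..r}" for n x using Xf that by (simp add: Y_def)
    have "a (N - p N) (p N) \<le> (\<Sum>j<N. a (N - j) j)"
      using N(1) p(2)[of N] less_imp_le[OF a0] by (intro member_le_sum) auto
    then have "a (N - p N) (p N) < \<delta>" using N(2) by simp

    then have small: "Y N r - Y N l < \<delta>" by (simp add: a_def Y_def)
    have near: "(1 - \<epsilon>) * (Y N y - Y N x) \<le> Y N (f y) - Y N (f x)"
      if "x \<in> {l..r}" "y \<in> {l..r}" "x < y" for x y
    proof -
      have "(1 - \<epsilon>) * (Y N y - Y N x) \<le> f (Y N y) - f (Y N x)"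
      proof (rule \<delta>(2)[OF Y01 _ _ small])
        show "f (Y N l) = Y N l" "f (Y N r) = Y N r" using Yf l_r f_lr by simp_all
        show "Y N l \<le> Y N x" "Y N y \<le> Y N r" using Y_lr that by (meson atLeastAtMost_iff)+
      qed (use Y_mono that in blast)
      then show ?thesis using Yf that by simp
    qed
    \<comment> \<open>At the end of the path each further application of \<open>f\<close> shrinks
      the gap by a factor of at least \<open>1 - \<epsilon>\<close>.\<close>
    have "(1 - \<epsilon>) ^ j * (Y N (f x0) - Y N x0) \<le> Y N ((f ^^ Suc j) x0) - Y N ((f ^^ j) x0)" for j
    proof (induction j)
      case (Suc j)
      have "(1 - \<epsilon>) ^ Suc j * (Y N (f x0) - Y N x0)
          \<le> (1 - \<epsilon>) * (Y N ((f ^^ Suc j) x0) - Y N ((f ^^ j) x0))"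
        using Suc \<epsilon>(2) mult_left_mono[OF Suc, of "1 - \<epsilon>"] by (simp add: mult.assoc)
      also have "\<dots> \<le> Y N ((f ^^ Suc (Suc j)) x0) - Y N ((f ^^ Suc j) x0)"
        using near[OF fk_in fk_in gap_pos, OF fx0(1) fx0(1)] by simp
      finally show ?case .
    qed simp
    then have "(1 - \<epsilon>) ^ k * (Y N (f x0) - Y N x0) \<le> Y N ((f ^^ Suc k) x0) - Y N ((f ^^ k) x0)" .
    moreover have "1/2 \<le> (1 - \<epsilon>) ^ k"
      using Bernoulli_inequality[of "-\<epsilon>" k] \<epsilon> by simp
    moreover have Y10: "Y N x0 < Y N (f x0)" using Y_mono fx0 x0(3) by blast
    ultimately have half: "(Y N (f x0) - Y N x0) / 2 \<le> Y N ((f ^^ Suc k) x0) - Y N ((f ^^ k) x0)"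
      using mult_right_mono[of "1/2" "(1 - \<epsilon>) ^ k" "Y N (f x0) - Y N x0"] by linarith
    have "(\<Sum>i<N. a (i - p i) (p i) powr \<beta>) \<le> a 0 0 powr \<beta> + (\<Sum>n=1..N. a (n - p n) (p n) powr \<beta>)"
    proof -
      have "(\<Sum>i<N. a (i - p i) (p i) powr \<beta>) \<le> (\<Sum>i=0..N. a (i - p i) (p i) powr \<beta>)"
        by (intro sum_mono2) auto
      also have "\<dots> = a 0 0 powr \<beta> + (\<Sum>n=1..N. a (n - p n) (p n) powr \<beta>)"
        by (simp add: sum.atLeast_Suc_atMost p(1))
      finally show ?thesis .
    qed
    then have expK: "exp (C * (\<Sum>i<N. a (i - p i) (p i) powr \<beta>)) \<le> K"
      using p(4) C by (simp add: K_def)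
    define J where "J = (f ^^ Suc k) x0 - (f ^^ k) x0"
    have J: "J > 0" using gap_pos by (simp add: J_def)
    \<comment> \<open>Bounded distortion carries the comparison of gaps from the end of the path
      back to \<open>[l, r]\<close>.\<close>
    have "(Y N (f x0) - Y N x0) / 2 * (f x0 - x0)
        \<le> (Y N ((f ^^ Suc k) x0) - Y N ((f ^^ k) x0)) * (f x0 - x0)"
      using half x0(3) by (intro mult_right_mono) auto
    also have "\<dots> \<le> exp (C * (\<Sum>i<N. a (i - p i) (p i) powr \<beta>)) * ((Y N (f x0) - Y N x0) * J)"
      unfolding J_def
    proof (rule Y_distortion)
      show "{(f ^^ k) x0, (f ^^ Suc k) x0, x0, f x0} \<subseteq> {l..r}" using fk_in[OF fx0(1)] fx0 by blast
    qed (use gap_pos x0(3) in blast)+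
    also have "\<dots> \<le> K * ((Y N (f x0) - Y N x0) * J)"
      using expK J Y10 by (intro mult_right_mono) auto
    finally have "(Y N (f x0) - Y N x0) * (f x0 - x0) \<le> (Y N (f x0) - Y N x0) * (2 * K * J)"
      by (simp add: mult_ac)
    then show ?thesis using Y10 by (simp add: J_def)
  qed
  \<comment> \<open>The gaps telescope inside an interval of length at most \<open>1\<close>, yet
    each is at least a fixed positive amount.\<close>
  have "real m * (f x0 - x0) \<le> 2 * K" for m
  proof -
    have "real m * (f x0 - x0) = (\<Sum>k<m. f x0 - x0)" by simp
    also have "\<dots> \<le> (\<Sum>k<m. 2 * K * ((f ^^ Suc k) x0 - (f ^^ k) x0))"
      using gap by (intro sum_mono) auto
    also have "\<dots> = 2 * K * ((f ^^ m) x0 - x0)"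
      unfolding sum_distrib_left[symmetric]
      using sum_lessThan_telescope[of "\<lambda>k. (f ^^ k) x0" m] by simp
    also have "\<dots> \<le> 2 * K * 1"
      using fk_in[OF fx0(1), of m] lr x0 by (intro mult_left_mono) (auto simp: K_def)
    finally show ?thesis by simp
  qed
  moreover obtain m :: nat where "2 * K < real m * (f x0 - x0)"
    using reals_Archimedean3[of "f x0 - x0"] x0(3) by auto
  ultimately show False by (meson not_le)
qed


section \<open>Actions of the Heisenberg group on the interval\<close>

text \<open>In matrix terms \<open>a, c, d, e, w\<close> are the entries \<open>(2,1), (4,3), (3,1), (4,2), (4,1)\<close>, counted
  from \<open>1\<close>; the symplectic pairs are \<open>a, e\<close> and \<open>c, d\<close>.\<close>

locale heisenberg_interval_action =
  fixes T :: "int \<Rightarrow> int \<Rightarrow> int \<Rightarrow> int \<Rightarrow> int \<Rightarrow> real \<Rightarrow> real"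
  assumes T01: "x \<in> {0..1} \<Longrightarrow> T a c d e w x \<in> {0..1}"
    and T_mono: "x \<in> {0..1} \<Longrightarrow> y \<in> {0..1} \<Longrightarrow> x < y \<Longrightarrow> T a c d e w x < T a c d e w y"
    and T_cont: "continuous_on {0..1} (T a c d e w)"
    and T_id: "x \<in> {0..1} \<Longrightarrow> T 0 0 0 0 0 x = x"
    and T_comp: "x \<in> {0..1} \<Longrightarrow> T a c d e w (T a' c' d' e' w' x) =
      T (a + a') (c + c') (d + d') (e + e') (w + w' + e * a' + c * d') x"
begin

abbreviation F :: "int \<Rightarrow> real \<Rightarrow> real" where
  "F \<equiv> T 0 0 0 0"

lemma T_mono_le: "x \<in> {0..1} \<Longrightarrow> y \<in> {0..1} \<Longrightarrow> x \<le> y \<Longrightarrow> T a c d e w x \<le> T a c d e w y"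
  using T_mono[of x y a c d e w] by (cases "x = y") auto

lemma F_T: "x \<in> {0..1} \<Longrightarrow> F t (T a c d e w x) = T a c d e (w + t) x"
  and T_F: "x \<in> {0..1} \<Longrightarrow> T a c d e w (F t x) = T a c d e (w + t) x"
  by (simp_all add: T_comp add.commute)

text \<open>When \<open>e * a + c * d = 0\<close>, the corner correction in \<open>T_comp\<close>
  vanishes between multiples of the same element, so negating the entries gives the inverse.\<close>

lemma T_uminus:
  assumes "e * a + c * d = 0" "x \<in> {0..1}"
  shows "T a c d e 0 (T (-a) (-c) (-d) (-e) 0 x) = x"
    and "T (-a) (-c) (-d) (-e) 0 (T a c d e 0 x) = x"
proof -
  have "c * d = - (e * a)" using assms(1) by linarith
  then show "T a c d e 0 (T (-a) (-c) (-d) (-e) 0 x) = x"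
    "T (-a) (-c) (-d) (-e) 0 (T a c d e 0 x) = x"
    using assms(2) by (simp_all add: T_comp T_id)
qed

lemma T_0: "T a c d e w 0 = 0"
proof -
  \<comment> \<open>The arguments are the entries of the inverse matrix, so \<open>y\<close> is the
    preimage of \<open>0\<close>.\<close>
  define y where "y = T (-a) (-c) (-d) (-e) (e * a + c * d - w) 0"
  have y: "y \<in> {0..1}" unfolding y_def by (rule T01) simp
  have "T a c d e w y = 0" unfolding y_def by (simp add: T_comp T_id)
  then show ?thesis using T_mono_le[of 0 y a c d e w] y T01[of 0 a c d e w] by auto
qed

lemma T_1: "T a c d e w 1 = 1"
proof -
  define y where "y = T (-a) (-c) (-d) (-e) (e * a + c * d - w) 1"
  have y: "y \<in> {0..1}" unfolding y_def by (rule T01) simp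
  have "T a c d e w y = 1" unfolding y_def by (simp add: T_comp T_id)
  then show ?thesis using T_mono_le[of y 1 a c d e w] y T01[of 1 a c d e w] by auto
qed

text \<open>\<open>l\<close> and \<open>r\<close> are the last fixed point before \<open>x0\<close>
  and the first one after it; they exist because the fixed point set is compact and contains
  \<open>0\<close> and \<open>1\<close>.\<close>

lemma fixed_point_free_component:
  assumes x0: "x0 \<in> {0..1}" "x0 < F 1 x0"
  obtains l r where "0 \<le> l" "r \<le> 1" "l < x0" "x0 < r" "F 1 l = l" "F 1 r = r"
    "\<And>y. l < y \<Longrightarrow> y < r \<Longrightarrow> F 1 y \<noteq> y"
proof -
  define Z where "Z = {x\<in>{0..1}. F 1 x = x}"
  have "closed {x\<in>{0..1}. F 1 x - x = 0}"
    by (intro continuous_closed_preimage_constant continuous_intros T_cont)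
  then have "closed Z" by (simp add: Z_def)
  have x0Z: "x0 \<notin> Z" using x0 by (simp add: Z_def)
  define A where "A = Z \<inter> {0..x0}"
  define B where "B = Z \<inter> {x0..1}"
  have "compact A" "compact B"
    unfolding A_def B_def using \<open>closed Z\<close> by (auto intro: closed_Int_compact)
  moreover have "0 \<in> A" "1 \<in> B" using x0 T_0 T_1 by (auto simp: A_def B_def Z_def)
  ultimately obtain l r where lr: "l \<in> A" "\<And>y. y \<in> A \<Longrightarrow> y \<le> l" "r \<in> B" "\<And>y. y \<in> B \<Longrightarrow> r \<le> y"
    using compact_attains_sup[of A] compact_attains_inf[of B] by blast
  show ?thesis
  proof (rule that[of l r])
    show "l < x0" "x0 < r" using lr x0Z by (auto simp: A_def B_def order_le_less)
    fix y assume y: "l < y" "y < r"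
    show "F 1 y \<noteq> y"
    proof
      assume "F 1 y = y"
      then have "y \<in> A \<or> y \<in> B" using y lr by (auto simp: A_def B_def Z_def)
      then show False using lr y by force
    qed
  qed (use lr in \<open>auto simp: A_def B_def Z_def\<close>)
qed

end

section \<open>A component of the complement of the fixed point set\<close>

locale heisenberg_component = heisenberg_interval_action +
  fixes l r x0 :: real
  assumes lr: "0 \<le> l" "r \<le> 1" "l < x0" "x0 < r" and fix_l: "F 1 l = l" and fix_r: "F 1 r = r"
    and no_fix: "l < y \<Longrightarrow> y < r \<Longrightarrow> F 1 y \<noteq> y" and F_x0: "x0 < F 1 x0"
begin

lemma in01: "x \<in> {l..r} \<Longrightarrow> x \<in> {0..1}"
  using lr by auto

lemma x0_in01: "x0 \<in> {0..1}"
  using lr by simp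

lemma F_nat_x0_less: "F (int n) x0 < F (int (Suc n)) x0"
proof (induction n)
  case 0
  then show ?case using F_x0 x0_in01 T_id by simp
next
  case (Suc n)
  have "F 1 (F (int n) x0) < F 1 (F (int (Suc n)) x0)"
    using x0_in01 T01 by (blast intro: T_mono Suc)
  then show ?case unfolding F_T[OF x0_in01] by (simp add: add.commute)
qed

text \<open>The orbit of \<open>x0\<close> is ordered like the integers, so it serves as a ruler for
  displacements inside the component.\<close>

lemma F_strict_mono:
  assumes "s < t"
  shows "F s x0 < F t x0"
proof -
  have "F (int 0) x0 < F (int (nat (t - s))) x0"
    by (rule lift_Suc_mono_less[of "\<lambda>n. F (int n) x0"]) (use F_nat_x0_less assms in simp_all)
  then have "F 0 x0 < F (t - s) x0" using assms by simp
  then have "F s (F 0 x0) < F s (F (t - s) x0)"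
    using x0_in01 T01 by (blast intro: T_mono)
  then show ?thesis unfolding F_T[OF x0_in01] by simp
qed

lemma F_fixed:
  assumes "x \<in> {0..1}" "F 1 x = x"
  shows "F t x = x"
proof (induction t rule: int_induct[where k = 0])
  case base
  show ?case by (rule T_id[OF assms(1)])
next
  case (step1 i)
  then show ?case using F_T[OF assms(1), of 1 0 0 0 0 i] assms(2) by simp
next
  case (step2 i)
  then show ?case using T_F[OF assms(1), of 0 0 0 0 "i - 1" 1] assms(2) by simp
qed

lemma F_lr: "F t l = l" "F t r = r"
  using F_fixed[OF _ fix_l] F_fixed[OF _ fix_r] lr by auto

text \<open>The increasing orbit converges to a fixed point of \<open>F 1\<close> in
  \<open>(x0, r]\<close>, and \<open>r\<close> is the only one.\<close>

lemma F_x0_tendsto_r: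
  assumes "z < r"
  obtains n :: nat where "z \<le> F (int n) x0"
proof -
  have x0: "x0 \<in> {0..1}" using in01[of x0] lr by simp
  have inc: "incseq (\<lambda>n. F (int n) x0)" using F_nat_x0_less by (intro incseq_SucI less_imp_le)
  have le_r: "F (int n) x0 \<le> r" for n
    using T_mono_le[of x0 r 0 0 0 0 "int n"] x0 lr F_lr by auto
  obtain L where L: "(\<lambda>n. F (int n) x0) \<longlonglongrightarrow> L" "\<And>n. F (int n) x0 \<le> L"
    using incseq_convergent[OF inc] le_r by blast
  have "L \<le> r" using L(1) le_r by (intro LIMSEQ_le_const2) auto
  have "x0 < L" using L(2)[of 1] F_x0 by simp
  have L01: "L \<in> {0..1}" using \<open>L \<le> r\<close> \<open>x0 < L\<close> lr by auto
  have "(\<lambda>n. F 1 (F (int n) x0)) \<longlonglongrightarrow> F 1 L"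
    using T_cont L01 T01[OF x0] L(1) by (intro continuous_on_tendsto_compose[OF T_cont]) auto
  moreover have "(\<lambda>n. F 1 (F (int n) x0)) \<longlonglongrightarrow> L"
    using LIMSEQ_Suc[OF L(1)] x0 by (simp add: F_T add.commute)
  ultimately have "F 1 L = L" by (rule LIMSEQ_unique)
  then have "L = r" using no_fix[of L] \<open>L \<le> r\<close> \<open>x0 < L\<close> lr by force
  then have "eventually (\<lambda>n. z < F (int n) x0) sequentially"
    using order_tendstoD(1)[OF L(1)] assms by simp
  then show ?thesis using that by (meson eventually_sequentially le_refl less_imp_le)
qed

section \<open>Isotropy of the stabilizer\<close>

text \<open>\<open>F 1\<close> is central, so it also fixes the preimage of \<open>r\<close>. If the
  claim failed, this preimage would lie in \<open>(l, x0]\<close>, where there is no fixed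
  point.\<close>

lemma stabilizer_maps_below_r:
  assumes "e * a + c * d = 0" "T a c d e 0 l = l"
  shows "T a c d e 0 x0 < r"
proof (rule ccontr)
  assume "\<not> T a c d e 0 x0 < r"
  have x: "x0 \<in> {0..1}" "l \<in> {0..1}" "r \<in> {0..1}" using lr by auto
  define y where "y = T (-a) (-c) (-d) (-e) 0 r"
  have y: "y \<in> {0..1}" unfolding y_def by (rule T01[OF x(3)])
  have Ty: "T a c d e 0 y = r"
    unfolding y_def by (rule T_uminus(1)[OF assms(1) x(3)])
  have "F 1 y = y"
    unfolding y_def F_T[OF x(3)] using T_F[OF x(3), of _ _ _ _ 0 1] fix_r by simp
  moreover have "l < y"
    using T_mono_le[OF y x(2), of a c d e 0] Ty assms(2) lr by linarith
  moreover have "y \<le> x0"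
    using T_mono[OF x(1) y, of a c d e 0] Ty \<open>\<not> T a c d e 0 x0 < r\<close> by linarith
  ultimately show False using no_fix[of y] lr by simp
qed

text \<open>One application moves \<open>x0\<close> at most to \<open>F k x0\<close> for some
  \<open>k\<close>, and displacements add under iteration because \<open>F\<close> is central. The
  condition \<open>e * a + c * d = 0\<close> makes the multiples of the entries actual
  powers.\<close>

lemma linear_growth:
  assumes p: "e * a + c * d = 0" "T a c d e 0 l = l"
  obtains K where "K \<ge> 0"
    "\<And>n::nat. T (int n * a) (int n * c) (int n * d) (int n * e) 0 x0 \<le> F (int n * K) x0"
proof -
  have x: "x0 \<in> {0..1}" "l \<in> {0..1}" "r \<in> {0..1}" using lr by auto
  obtain k :: nat where k: "T a c d e 0 x0 \<le> F (int k) x0"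
    using F_x0_tendsto_r[OF stabilizer_maps_below_r[OF p]] by blast
  have "T (int n * a) (int n * c) (int n * d) (int n * e) 0 x0 \<le> F (int n * int k) x0" for n
  proof (induction n)
    case (Suc n)
    have "e * (int n * a) + c * (int n * d) = int n * (e * a + c * d)" by (simp add: algebra_simps)
    also have "\<dots> = 0" using p(1) by simp
    finally have "T (int (Suc n) * a) (int (Suc n) * c) (int (Suc n) * d) (int (Suc n) * e) 0 x0
        = T a c d e 0 (T (int n * a) (int n * c) (int n * d) (int n * e) 0 x0)"
      using x by (simp add: T_comp algebra_simps)
    also have "\<dots> \<le> T a c d e 0 (F (int n * int k) x0)"
      using Suc x T01 by (intro T_mono_le) auto
    also have "\<dots> = F (int n * int k) (T a c d e 0 x0)" using x by (simp add: F_T T_F)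
    also have "\<dots> \<le> F (int n * int k) (F (int k) x0)"
      using k x T01 by (intro T_mono_le) auto
    also have "\<dots> = F (int (Suc n) * int k) x0" using x by (simp add: F_T algebra_simps)
    finally show ?case .
  qed (use x in simp)
  then show ?thesis using that[of "int k"] by simp
qed

lemma T_uminus_fixes_l:
  assumes "e * a + c * d = 0" "T a c d e 0 l = l"
  shows "T (-a) (-c) (-d) (-e) 0 l = l"
proof -
  have l: "l \<in> {0..1}" using lr by simp
  show ?thesis using T_uminus(2)[OF assms(1) l] by (simp add: assms(2))
qed

lemma T_le_F_add:
  assumes "y \<in> {0..1}" "y \<le> F s x0" "T a c d e 0 x0 \<le> F t x0"
  shows "T a c d e 0 y \<le> F (s + t) x0"
proof -
  have x: "x0 \<in> {0..1}" using lr by auto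
  have "T a c d e 0 y \<le> T a c d e 0 (F s x0)"
    using assms T01[OF x] by (intro T_mono_le)
  also have "\<dots> = F s (T a c d e 0 x0)" using x by (simp add: F_T T_F)
  also have "\<dots> \<le> F s (F t x0)" using assms T01[OF x] by (intro T_mono_le)
  also have "\<dots> = F (s + t) x0" using x by (simp add: F_T add.commute)
  finally show ?thesis .
qed

text \<open>The commutator of \<open>n\<close>-th powers is \<open>F\<close> to a power quadratic in \<open>n\<close>, but moves \<open>x0\<close> only
  linearly far in terms of \<open>F\<close>.\<close>

lemma stabilizer_isotropic_le:
  assumes p: "e * a + c * d = 0" "T a c d e 0 l = l"
    and q: "e' * a' + c' * d' = 0" "T a' c' d' e' 0 l = l"
  shows "e * a' + c * d' \<le> e' * a + c' * d"
proof (rule ccontr)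
  define \<omega> where "\<omega> = e * a' + c * d' - (e' * a + c' * d)"
  assume "\<not> e * a' + c * d' \<le> e' * a + c' * d"
  then have \<omega>: "1 \<le> \<omega>" by (simp add: \<omega>_def)
  have x: "x0 \<in> {0..1}" using lr by auto
  have p': "(-e) * (-a) + (-c) * (-d) = 0" and q': "(-e') * (-a') + (-c') * (-d') = 0"
    using p q by simp_all
  obtain K1 where K1: "K1 \<ge> 0"
    "\<And>n::nat. T (int n * a) (int n * c) (int n * d) (int n * e) 0 x0 \<le> F (int n * K1) x0"
    using linear_growth[OF p] by metis
  obtain K2 where K2: "K2 \<ge> 0"
    "\<And>n::nat. T (int n * a') (int n * c') (int n * d') (int n * e') 0 x0 \<le> F (int n * K2) x0"
    using linear_growth[OF q] by metis
  obtain K3 where K3: "K3 \<ge> 0"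
    "\<And>n::nat. T (int n * (-a)) (int n * (-c)) (int n * (-d)) (int n * (-e)) 0 x0 \<le> F (int n * K3) x0"
    using linear_growth[OF p' T_uminus_fixes_l[OF p]] by metis
  obtain K4 where K4: "K4 \<ge> 0"
    "\<And>n::nat. T (int n * (-a')) (int n * (-c')) (int n * (-d')) (int n * (-e')) 0 x0 \<le> F (int n * K4) x0"
    using linear_growth[OF q' T_uminus_fixes_l[OF q]] by metis
  define K where "K = K4 + K3 + K2 + K1"
  \<comment> \<open>For this \<open>n\<close> the quadratic displacement
    \<open>n * n * \<omega>\<close> exceeds the linear bound \<open>n * K\<close>.\<close>
  define n where "n = nat (K + 1)"
  have n: "int n = K + 1" using K1 K2 K3 K4 by (simp add: n_def K_def)
  let ?z = "T (int n * (-a')) (int n * (-c')) (int n * (-d')) (int n * (-e')) 0 x0"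
  let ?y = "T (int n * (-a)) (int n * (-c)) (int n * (-d)) (int n * (-e)) 0 ?z"
  let ?x = "T (int n * a') (int n * c') (int n * d') (int n * e') 0 ?y"
  have z: "?z \<in> {0..1}" and y: "?y \<in> {0..1}" and x': "?x \<in> {0..1}" by (intro T01 x)+
  have "?y \<le> F (int n * K4 + int n * K3) x0" by (rule T_le_F_add[OF z K4(2) K3(2)])
  then have "?x \<le> F (int n * K4 + int n * K3 + int n * K2) x0" by (rule T_le_F_add[OF y _ K2(2)])
  then have "T (int n * a) (int n * c) (int n * d) (int n * e) 0 ?x
      \<le> F (int n * K4 + int n * K3 + int n * K2 + int n * K1) x0" by (rule T_le_F_add[OF x' _ K1(2)])
  also have "int n * K4 + int n * K3 + int n * K2 + int n * K1 = int n * K"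
    by (simp add: K_def algebra_simps)
  \<comment> \<open>The composition is a commutator, hence a power of \<open>F 1\<close>; the two
    subtracted terms vanish by assumption.\<close>
  also have "T (int n * a) (int n * c) (int n * d) (int n * e) 0 ?x
      = F (int n * int n * (\<omega> - (e * a + c * d) - (e' * a' + c' * d'))) x0"
    using x by (simp add: T_comp T01 \<omega>_def algebra_simps)
  finally have "F (int n * int n * \<omega>) x0 \<le> F (int n * K) x0" using p q by simp
  then have "int n * int n * \<omega> \<le> int n * K"
    using F_strict_mono[of "int n * K" "int n * int n * \<omega>"] by linarith
  moreover have "int n > 0" using n K1 K2 K3 K4 by (simp add: K_def)
  ultimately have "int n * \<omega> \<le> K" by (simp add: mult.assoc)
  moreover have "int n * 1 \<le> int n * \<omega>" using \<omega> by (intro mult_left_mono) auto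
  ultimately show False using n by simp
qed

lemma stabilizer_isotropic:
  assumes "e * a + c * d = 0" "T a c d e 0 l = l"
    and "e' * a' + c' * d' = 0" "T a' c' d' e' 0 l = l"
  shows "e * a' + c * d' = e' * a + c' * d"
  using stabilizer_isotropic_le[OF assms] stabilizer_isotropic_le[OF assms(3,4,1,2)] by simp

text \<open>An isotropic subspace of a four-dimensional symplectic space is transverse to one of the
  four coordinate Lagrangian planes.\<close>

lemma transverse_coordinate_pair:
  "\<exists>a e c d. e * a = 0 \<and> c * d = 0 \<and>
    (\<forall>i j. T (i * a) (j * c) (j * d) (i * e) 0 l = l \<longrightarrow> i = 0 \<and> j = 0)"
proof (rule ccontr)
  assume contra: "\<not> ?thesis"
  have ex: "\<exists>i j. T (i * a) (j * c) (j * d) (i * e) 0 l = l \<and> (i \<noteq> 0 \<or> j \<noteq> 0)"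
    if "e * a = 0" "c * d = 0" for a e c d
    proof (rule ccontr)
    assume "\<not> ?thesis"
    then have "\<forall>i j. T (i * a) (j * c) (j * d) (i * e) 0 l = l \<longrightarrow> i = 0 \<and> j = 0" by blast
    with that contra show False by (elim notE) (intro exI conjI)
  qed
  \<comment> \<open>Each coordinate plane contains a nonzero vector of the stabilizer. Pairing the
    four vectors two by two forces \<open>i3 = i4 = 0\<close>, and then \<open>j3 * j4 = 0\<close>
    makes one of the last two vanish.\<close>
  obtain i1 j1 where 1: "T i1 j1 0 0 0 l = l" "i1 \<noteq> 0 \<or> j1 \<noteq> 0"
    using ex[where e = 0 and a = 1 and c = 1 and d = 0] unfolding mult_1_right mult_zero_right by blast
  obtain i2 j2 where 2: "T i2 0 j2 0 0 l = l" "i2 \<noteq> 0 \<or> j2 \<noteq> 0"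
    using ex[where e = 0 and a = 1 and c = 0 and d = 1] unfolding mult_1_right mult_zero_right by blast
  obtain i3 j3 where 3: "T 0 j3 0 i3 0 l = l" "i3 \<noteq> 0 \<or> j3 \<noteq> 0"
    using ex[where e = 1 and a = 0 and c = 1 and d = 0] unfolding mult_1_right mult_zero_right by blast
  obtain i4 j4 where 4: "T 0 0 j4 i4 0 l = l" "i4 \<noteq> 0 \<or> j4 \<noteq> 0"
    using ex[where e = 1 and a = 0 and c = 0 and d = 1] unfolding mult_1_right mult_zero_right by blast
  have 12: "j1 * j2 = 0" using stabilizer_isotropic[OF _ 1(1) _ 2(1)] by simp
  have 34: "j3 * j4 = 0" using stabilizer_isotropic[OF _ 3(1) _ 4(1)] by simp
  have 13: "i3 * i1 = 0" using stabilizer_isotropic[OF _ 1(1) _ 3(1)] by simp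
  have 24: "i4 * i2 = 0" using stabilizer_isotropic[OF _ 2(1) _ 4(1)] by simp
  have 14: "j1 * j4 = i4 * i1" using stabilizer_isotropic[OF _ 1(1) _ 4(1)] by simp
  have 23: "0 = i3 * i2 + j3 * j2" using stabilizer_isotropic[OF _ 2(1) _ 3(1)] by simp
  have "i3 = 0 \<and> i4 = 0"
  proof (cases "j1 = 0")
    case True
    then show ?thesis using 1(2) 13 14 by simp
  next
    case False
    then have "j2 = 0" using 12 by simp
    then show ?thesis using 2(2) 24 23 by simp
  qed
  then show False using 34 3(2) 4(2) by simp
qed

section \<open>Disjoint translates and the contradiction\<close>

text \<open>Since \<open>F 1\<close> is central, it fixes the left endpoint of every translate and
  has no fixed point inside one. So no left endpoint lies inside another translate.\<close>

lemma translates_disjoint: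
  assumes p: "e * a + c * d = 0" and q: "e' * a' + c' * d' = 0"
    and ne: "T a c d e 0 l \<noteq> T a' c' d' e' 0 l"
  shows "T a c d e 0 r \<le> T a' c' d' e' 0 l \<or> T a' c' d' e' 0 r \<le> T a c d e 0 l"
proof -
  have l01: "l \<in> {0..1}" and r01: "r \<in> {0..1}" using lr by auto
  have no_fix_translate: "F 1 y \<noteq> y"
    if "e * a + c * d = 0" "T a c d e 0 l < y" "y < T a c d e 0 r" for a c d e y
  proof
    assume Fy: "F 1 y = y"
    have y: "y \<in> {0..1}" using that T01[OF l01, of a c d e 0] T01[OF r01, of a c d e 0] by auto
    define z where "z = T (-a) (-c) (-d) (-e) 0 y"
    have z: "z \<in> {0..1}" unfolding z_def by (rule T01[OF y])
    have Tz: "T a c d e 0 z = y"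
      unfolding z_def by (rule T_uminus(1)[OF that(1) y])
    have "F 1 z = z"
      unfolding z_def F_T[OF y] using T_F[OF y, of _ _ _ _ 0 1] Fy by simp
    moreover have "l < z" using T_mono_le[OF z l01, of a c d e 0] Tz that by linarith
    moreover have "z < r" using T_mono_le[OF r01 z, of a c d e 0] Tz that by linarith
    ultimately show False using no_fix by blast
  qed
  have F_fix: "F 1 (T a c d e 0 l) = T a c d e 0 l" for a c d e
    unfolding F_T[OF l01] using T_F[OF l01, of _ _ _ _ 0 1] fix_l by simp
  have "\<not> (T a c d e 0 l < T a' c' d' e' 0 l \<and> T a' c' d' e' 0 l < T a c d e 0 r)"
    using no_fix_translate[OF p] F_fix by blast
  moreover have "\<not> (T a' c' d' e' 0 l < T a c d e 0 l \<and> T a c d e 0 l < T a' c' d' e' 0 r)"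
    using no_fix_translate[OF q] F_fix by blast
  ultimately show ?thesis using ne by linarith
qed

lemma not_Diff01_action:
  assumes \<alpha>: "\<alpha> > 1/2" and diff: "\<And>a c d e w. T a c d e w \<in> carrier (Diff01 \<alpha>)"
  shows False
proof -
  \<comment> \<open>The averaging argument needs an exponent below \<open>1\<close>.\<close>
  define \<beta> where "\<beta> = min \<alpha> (3/4)"
  have \<beta>: "1/2 < \<beta>" "\<beta> < 1" "0 < \<beta>" "\<beta> \<le> \<alpha>" using \<alpha> by (auto simp: \<beta>_def)
  obtain a e c d where ae: "e * a = 0" and cd: "c * d = 0"
    and free: "\<And>i j. T (i * a) (j * c) (j * d) (i * e) 0 l = l \<Longrightarrow> i = 0 \<and> j = 0"
    using transverse_coordinate_pair by blast
  obtain C where C: "C > 0" "distortion_bound \<beta> C (T a 0 0 e 0)"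
    using Diff01_distortion_bound[OF \<beta>(3,4) diff] by blast
  obtain D where D: "D > 0" "distortion_bound \<beta> D (T 0 c d 0 0)"
    using Diff01_distortion_bound[OF \<beta>(3,4) diff] by blast
  obtain f' where f': "C1_deriv (F 1) f'" using diff Diff01_carrier by blast
  \<comment> \<open>On the chosen plane the corner correction is zero, so \<open>P\<close> is an
    action of \<open>\<int>\<^sup>2\<close> commuting with \<open>F\<close>.\<close>
  define P where "P i j = T (i * a) (j * c) (j * d) (i * e) 0" for i j
  have iso: "(i * e) * (i' * a) = 0" "(j * c) * (j' * d) = 0" for i i' j j' :: int
    using ae cd by (simp_all only: mult.commute[of i' a] mult.commute[of j' d])  auto
  have iso_sum: "(i * e) * (i' * a) + (j * c) * (j' * d) = 0" for i i' j j' :: int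
    unfolding iso by simp
  have P_comp: "P i j (P i' j' x) = P (i + i') (j + j') x" if "x \<in> {0..1}" for i j i' j' x
    unfolding P_def T_comp[OF that] iso by (simp only: distrib_right add_0_right)
  have l01: "l \<in> {0..1}" using lr by auto
  show False
  proof (rule no_two_dimensional_wandering_interval[where X = "\<lambda>i j. P (int i) (int j)"])
    have "strict_mono_on {0..1} (T a c d e w)" for a c d e w
      using diff Diff01_carrier by blast
    then show "distortion_bound \<beta> (max C D) (T a 0 0 e 0)" "distortion_bound \<beta> (max C D) (T 0 c d 0 0)"
      using distortion_bound_mono[OF C(2)] distortion_bound_mono[OF D(2)] by simp_all
    show "F 1 x \<in> {l..r}" if "x \<in> {l..r}" for x
      using T_mono_le[of l x 0 0 0 0 1] T_mono_le[of x r 0 0 0 0 1] that in01 lr fix_l fix_r by auto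
    show "P (int 0) (int 0) x = x" if "x \<in> {l..r}" for x
      using in01[OF that] by (simp add: P_def T_id)
    show "P (int (Suc i)) (int j) x = T a 0 0 e 0 (P (int i) (int j) x)" if "x \<in> {l..r}" for i j x
      using P_comp[OF in01[OF that], of 1 0 "int i" "int j"] by (simp add: P_def)
    show "P (int i) (int (Suc j)) x = T 0 c d 0 0 (P (int i) (int j) x)" if "x \<in> {l..r}" for i j x
      using P_comp[OF in01[OF that], of 0 1 "int i" "int j"] by (simp add: P_def)
    show "F 1 (P (int i) (int j) x) = P (int i) (int j) (F 1 x)" if "x \<in> {l..r}" for i j x
      using in01[OF that] by (simp add: P_def F_T T_F)
    show "P (int i) (int j) x \<in> {0..1}" if "x \<in> {l..r}" for i j x
      unfolding P_def by (intro T01 in01 that)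
    show "P (int i) (int j) x < P (int i) (int j) y" if "x \<in> {l..r}" "y \<in> {l..r}" "x < y" for i j x y
      unfolding P_def by (intro T_mono in01 that)
    show "F 1 x < F 1 y" if "x \<in> {l..r}" "y \<in> {l..r}" "x < y" for x y
      by (intro T_mono in01 that)
    show "0 < max C D" using C(1) by simp
    fix i j i' j' :: nat assume ne: "(i, j) \<noteq> (i', j')"
    have "P (int i) (int j) l \<noteq> P (int i') (int j') l"
    proof
      assume "P (int i) (int j) l = P (int i') (int j') l"
      then have "P (- int i') (- int j') (P (int i) (int j) l) = l"
        using P_comp[OF l01, of "- int i'" "- int j'" "int i'" "int j'"] T_id[OF l01]
        by (simp add: P_def)
      then have "P (int i - int i') (int j - int j') l = l"
        using P_comp[OF l01] by simp
      then have "int i - int i' = 0 \<and> int j - int j' = 0" unfolding P_def by (rule free)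
      then show False using ne by simp
    qed
    then show "P (int i) (int j) r \<le> P (int i') (int j') l \<or> P (int i') (int j') r \<le> P (int i) (int j) l"
      unfolding P_def by (rule translates_disjoint[OF iso_sum iso_sum])
  qed (fact \<beta> f' lr F_x0 fix_l fix_r)+
qed

end

section \<open>Triviality of the center\<close>

context heisenberg_interval_action
begin

lemma Diff01_center_le:
  assumes "\<alpha> > 1/2" and diff: "\<And>a c d e w. T a c d e w \<in> carrier (Diff01 \<alpha>)"
    and x: "x \<in> {0..1}"
  shows "F 1 x \<le> x"
proof (rule ccontr)
  assume "\<not> F 1 x \<le> x"
  then have less: "x < F 1 x" by simp
  from fixed_point_free_component[OF x less] obtain l r where
    lr: "0 \<le> l" "r \<le> 1" "l < x" "x < r" "F 1 l = l" "F 1 r = r"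
      "\<And>y. l < y \<Longrightarrow> y < r \<Longrightarrow> F 1 y \<noteq> y" by blast
  interpret heisenberg_component T l r x
    by unfold_locales (fact lr less)+
  show False using not_Diff01_action[OF assms(1) diff] .
qed

text \<open>Negating \<open>a\<close>, \<open>d\<close> and \<open>w\<close> is an automorphism of
  the Heisenberg group, as \<open>e * a'\<close> and \<open>c * d'\<close> change sign too. It
  inverts the central generator, so the one-sided bound for \<open>F 1\<close> also applies to
  \<open>F (-1)\<close>.\<close>

lemma center_inverted: "heisenberg_interval_action (\<lambda>a c d e w. T (-a) c (-d) e (-w))"
proof
  show "T (-a) c (-d) e (-w) (T (-a') c' (-d') e' (-w') x)
      = T (-(a + a')) (c + c') (-(d + d')) (e + e') (-(w + w' + e * a' + c * d')) x"
    if "x \<in> {0..1}" for a c d e w a' c' d' e' w' x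
    using that by (simp add: T_comp)
qed (use T01 T_mono T_cont T_id in \<open>simp_all only: minus_zero\<close>)

lemma Diff01_center_trivial:
  assumes \<alpha>: "\<alpha> > 1/2" and diff: "\<And>a c d e w. T a c d e w \<in> carrier (Diff01 \<alpha>)"
    and x: "x \<in> {0..1}"
  shows "F 1 x = x"
proof (rule antisym)
  show "F 1 x \<le> x" by (rule Diff01_center_le[OF assms])
  interpret inverted: heisenberg_interval_action "\<lambda>a c d e w. T (-a) c (-d) e (-w)"
    by (rule center_inverted)
  have "F (-1) x \<le> x" using inverted.Diff01_center_le[OF \<alpha> diff x] by simp
  then have "F 1 (F (-1) x) \<le> F 1 x" using x T01 by (intro T_mono_le) auto
  then show "x \<le> F 1 x" using F_T[OF x, of 1 0 0 0 0 "-1"] T_id[OF x] by simp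
qed

end

section \<open>The Heisenberg subgroup of \<open>N4\<close>\<close>

definition heisenberg_matrix :: "int \<Rightarrow> int \<Rightarrow> int \<Rightarrow> int \<Rightarrow> int \<Rightarrow> int ^ 4 ^ 4" where
  "heisenberg_matrix a c d e w = (\<chi> i j. if i = j then 1 else
     if i = 1 \<and> j = 0 then a else if i = 3 \<and> j = 2 then c else if i = 2 \<and> j = 0 then d else
     if i = 3 \<and> j = 1 then e else if i = 3 \<and> j = 0 then w else 0)"

lemma heisenberg_matrix_carrier: "heisenberg_matrix a c d e w \<in> carrier N4"
  using less_index4 by (auto simp: N4_carrier heisenberg_matrix_def)

lemma heisenberg_matrix_mult:
  "heisenberg_matrix a c d e w \<otimes>\<^bsub>N4\<^esub> heisenberg_matrix a' c' d' e' w' =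
   heisenberg_matrix (a + a') (c + c') (d + d') (e + e') (w + w' + e * a' + c * d')"
  using less_index4
  by (auto simp: N4_def vec_eq_iff forall_index4 matrix_mult_index4 heisenberg_matrix_def)

lemma heisenberg_matrix_zero: "heisenberg_matrix 0 0 0 0 0 = \<one>\<^bsub>N4\<^esub>"
  by (simp add: N4_def vec_eq_iff heisenberg_matrix_def mat_def)

lemma heisenberg_matrix_center_neq: "heisenberg_matrix 0 0 0 0 1 \<noteq> heisenberg_matrix 0 0 0 0 0"
proof
  assume "heisenberg_matrix 0 0 0 0 1 = heisenberg_matrix 0 0 0 0 0"
  then have "heisenberg_matrix 0 0 0 0 1 $ 3 $ 0 = heisenberg_matrix 0 0 0 0 0 $ 3 $ 0" by simp
  then show False using less_index4 by (auto simp: heisenberg_matrix_def)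
qed

theorem theoremB:
  fixes \<alpha> :: real
  assumes "\<alpha> > 1/2"
  shows "\<not> (\<exists>\<phi> \<in> hom N4 (Diff01 \<alpha>). inj_on \<phi> (carrier N4))"
proof
  assume "\<exists>\<phi> \<in> hom N4 (Diff01 \<alpha>). inj_on \<phi> (carrier N4)"
  then obtain \<phi> where hom: "\<phi> \<in> hom N4 (Diff01 \<alpha>)" and inj: "inj_on \<phi> (carrier N4)" by blast
  have "\<alpha> > 0" using assms by simp
  define T where "T a c d e w = \<phi> (heisenberg_matrix a c d e w)" for a c d e w
  have diff: "T a c d e w \<in> carrier (Diff01 \<alpha>)" for a c d e w
    unfolding T_def using hom heisenberg_matrix_carrier by (rule hom_in_carrier)
  have one: "T 0 0 0 0 0 = (\<lambda>x\<in>{0..1}. x)"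
    unfolding T_def heisenberg_matrix_zero
    using hom_one[OF hom N4_group Diff01_group[OF \<open>\<alpha> > 0\<close>]] by (simp add: Diff01_def)
  interpret heisenberg_interval_action T
  proof
    fix a c d e w
    have bij: "bij_betw (T a c d e w) {0..1} {0..1}" and mono: "strict_mono_on {0..1} (T a c d e w)"
      and "\<exists>f'. C1_deriv (T a c d e w) f'"
      using diff Diff01_carrier by blast+
    then show "continuous_on {0..1} (T a c d e w)"
      unfolding C1_deriv_def by (meson DERIV_continuous continuous_on_eq_continuous_within)
    show "T a c d e w x \<in> {0..1}" if "x \<in> {0..1}" for x
      using bij that by (rule bij_betwE[rule_format])
    show "T a c d e w x < T a c d e w y" if "x \<in> {0..1}" "y \<in> {0..1}" "x < y" for x y
      using strict_mono_onD[OF mono that] .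
  next
    fix a c d e w a' c' d' e' w' and x :: real
    assume x: "x \<in> {0..1}"
    have "T (a + a') (c + c') (d + d') (e + e') (w + w' + e * a' + c * d')
        = compose {0..1} (T a c d e w) (T a' c' d' e' w')"
      unfolding T_def heisenberg_matrix_mult[symmetric]
      using hom_mult[OF hom heisenberg_matrix_carrier heisenberg_matrix_carrier]
      by (simp add: Diff01_def)
    then show "T a c d e w (T a' c' d' e' w' x) =
        T (a + a') (c + c') (d + d') (e + e') (w + w' + e * a' + c * d') x"
      using x by (simp add: compose_eq)
  qed (simp add: one)
  \<comment> \<open>The corner generator and the identity get the same image: the two maps agree on
    \<open>[0,1]\<close>, and both are \<open>undefined\<close> outside.\<close>
  have "T 0 0 0 0 1 = T 0 0 0 0 0"
  proof
    fix x
    show "T 0 0 0 0 1 x = T 0 0 0 0 0 x"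
    proof (cases "x \<in> {0..1}")
      case True
      then show ?thesis using Diff01_center_trivial[OF assms diff] T_id by simp
    next
      case False
      have "T 0 0 0 0 w \<in> extensional {0..1}" for w using diff Diff01_carrier by blast
      then show ?thesis using False by (simp add: extensional_def)
    qed
  qed
  then show False
    using inj_onD[OF inj _ heisenberg_matrix_carrier heisenberg_matrix_carrier]
      heisenberg_matrix_center_neq by (auto simp: T_def)
qed

end
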